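(* For each small Mach number $M>0$ let $(\rho^n_{i,j},\mathbf v^n_{i,j},\Lambda^n_{i,j})$ be a solution of the fully discrete scheme (S1)--(S3), (B1), (B2) described in the context, with artificial viscosity coefficient $\mu_h:=h\|\mathbf v_0^n\|_\infty$ in time step $n$. Assume the expansions, as $M\to 0$, $$\rho^n_{i,j}=\rho^n_{0,i,j}+M^2\rho^n_{1,i,j}+o(M^2),\quad \mathbf v^n_{i,j}=\mathbf v^n_{0,i,j}+o(1),\quad \Lambda^n_{i,j}=\Lambda^n_{0,i,j}+M^2\Lambda^n_{1,i,j}+o(M^2),$$ and that $W'(\rho^0_{0,i,j})-\gamma(\Delta_h\rho^0_0)_{i,j}=\text{const}$ (independent of $(i,j)$), $(\operatorname{div}_h(\rho^0_0\mathbf v^0_0))_{i,j}=0$ and $\rho^0_{0,i,j}>0$ for all $(i,j)\in\{0,\dots,K\}^2$. If the time step satisfies $$\tau_n<\frac{h}{\|\mathbf v_0^n\|_\infty}\,\frac{\rho_0^{\min}}{9\|\rho_0^0\|_\infty^2+8},\qquad \rho_0^{\min}:=\min_{(i,j)\in\{0,\dots,K\}^2}\rho^0_{0,i,j},$$ then $$\sum_{i,j=0}^K\rho^0_{0,i,j}|\mathbf v^{n+1}_{0,i,j}|^2\le\sum_{i,j=0}^K\rho^0_{0,i,j}|\mathbf v^n_{0,i,j}|^2+\frac{\mu_h\tau_n}{h^2}\sum_{(i,j)\in\partial\Omega}|\mathbf v^{n+1}_{0,i,j}-\mathbf v^n_{0,i,j}|^2+4\frac{\mu_h\tau_n}{h^2}\sum_{(i,j)\in\partial\Omega}\mathbf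 v^n_{0,i,j}\cdot(\mathbf v^n_{0,i,j}-\mathbf v^{n+1}_{0,i,j}).$$
   Context: Setting. $\Omega=[0,1]^2$, $K\in\mathbb N$, $h=1/K$; grid functions are indexed by $(i,j)\in\{0,\dots,K\}^2$, corresponding to the points $(ih,jh)$. In sums, $\partial\Omega$ denotes the index set $\{(i,j)\in\{0,\dots,K\}^2: i\in\{0,K\}\text{ or }j\in\{0,K\}\}$. $\|\cdot\|_\infty$ is the maximum norm over $\{0,\dots,K\}^2$. Times $0=t_0<\dots<t_N=T$, $\tau_n=t_{n+1}-t_n$. $M>0$ is the Mach number, $\gamma>0$ a fixed capillarity coefficient. $W\in C^2((0,\infty),[0,\infty))$ is a double-well energy density: there are $0<\alpha<\beta<\infty$ such that $W$ is strictly convex on $(0,\alpha)\cup(\beta,\infty)$ and strictly concave on $(\alpha,\beta)$. It is decomposed as $W=U-V$ with $U,V$ convex $C^2$-functions and $V''\ge\kappa_V>0$. Write $\mathbf v=(u,w)^T$. Difference operators, for a scalar grid function $f$ and a vector grid function $\mathbf f=(f^1,f^2)^T$: $(\nabla_h f)_{i,j}=\frac1{2h}(f_{i+1,j}-f_{i-1,j},\,f_{i,j+1}-f_{i,j-1})^T$; $(\operatorname{div}_h\mathbf f)_{i,j}=\frac1{2h}(f^1_{i+1,j}-f^1_{i-1,j}+f^2_{i,j+1}-f^2_{i,j-1})$; $(\Delta_hf)_{i,j}=\frac1{h^2}(f_{i+1,j}+f_{i-1,j}+f_{i,j+1}+f_{i,j-1}-4f_{i,j})$ (componentwise on vectors);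 $(\widetilde{\operatorname{div}}_h(\rho\mathbf v\otimes\mathbf v))_{i,j}=\frac1{4h}\big((\mathbf v_{i,j}+\mathbf v_{i+1,j})(\rho_{i,j}u_{i,j}+\rho_{i+1,j}u_{i+1,j})-(\mathbf v_{i,j}+\mathbf v_{i-1,j})(\rho_{i,j}u_{i,j}+\rho_{i-1,j}u_{i-1,j})+(\mathbf v_{i,j}+\mathbf v_{i,j+1})(\rho_{i,j}w_{i,j}+\rho_{i,j+1}w_{i,j+1})-(\mathbf v_{i,j}+\mathbf v_{i,j-1})(\rho_{i,j}w_{i,j}+\rho_{i,j-1}w_{i,j-1})\big)$. Scheme, for $(i,j)\in\{0,\dots,K\}^2$ and $n\in\{0,\dots,N-1\}$: (S1) $\rho^{n+1}_{i,j}-\rho^n_{i,j}+\tau_n\operatorname{div}_h(\rho^{n+1}\mathbf v^{n+1})_{i,j}=0$; (S2) $\rho^{n+1}_{i,j}\mathbf v^{n+1}_{i,j}-\rho^n_{i,j}\mathbf v^n_{i,j}+\tau_n\widetilde{\operatorname{div}}_h(\rho^n\mathbf v^n\otimes\mathbf v^n)_{i,j}+\rho^n_{i,j}\frac{\tau_n}{M^2}(\nabla_h\Lambda^{n+1})_{i,j}-\mu_h\tau_n(\Delta_h\mathbf v^n)_{i,j}=\mathbf 0$; (S3) $\Lambda^{n+1}_{i,j}-U'(\rho^{n+1}_{i,j})+V'(\rho^n_{i,j})+\gamma(\Delta_h\rho^{n+1})_{i,j}=0$. Boundary conditions (ghost cells), at all time levels: (B1) $\rho_{-1,j}=\rho_{0,j}$,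 $\rho_{K+1,j}=\rho_{K,j}$, $\rho_{i,-1}=\rho_{i,0}$, $\rho_{i,K+1}=\rho_{i,K}$, and analogously for $\Lambda$; (B2) $\mathbf v_{-1,j}=-\mathbf v_{0,j}$, $\mathbf v_{K+1,j}=-\mathbf v_{K,j}$, $\mathbf v_{i,-1}=-\mathbf v_{i,0}$, $\mathbf v_{i,K+1}=-\mathbf v_{i,K}$. All difference operators use these extensions (also for the leading-order coefficients). *)

theory Defs
  imports "HOL-Analysis.Analysis" "HOL-Library.Landau_Symbols"
begin

section \<open>Grid functions\<close>

text \<open>
  Grid functions are functions on all of \<open>\<int> \<times> \<int>\<close>. Only the indices in \<open>{-1..K+1}\<close> matter: the
  layers \<open>-1\<close> and \<open>K+1\<close> are the ghost cells, whose values are prescribed by the predicates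
  \<open>even_ghosts\<close> and \<open>odd_ghosts\<close> below.
\<close>

type_synonym 'a grid_fun = "int \<Rightarrow> int \<Rightarrow> 'a"

definition grid :: "nat \<Rightarrow> (int \<times> int) set" where
  "grid K = {0..int K} \<times> {0..int K}"

definition bdry :: "nat \<Rightarrow> (int \<times> int) set" where
  "bdry K = {(i, j) \<in> grid K. i \<in> {0, int K} \<or> j \<in> {0, int K}}"

definition mesh :: "nat \<Rightarrow> real" where
  "mesh K = 1 / real K"

text \<open>For vector-valued grid functions this is the maximum of the Euclidean norms.\<close>

definition maxnorm :: "nat \<Rightarrow> 'a::real_normed_vector grid_fun \<Rightarrow> real" where
  "maxnorm K f = Max ((\<lambda>(i, j). norm (f i j)) ` grid K)"

definition gridmin :: "nat \<Rightarrow> real grid_fun \<Rightarrow> real" where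
  "gridmin K f = Min ((\<lambda>(i, j). f i j) ` grid K)"

definition even_ghosts :: "nat \<Rightarrow> 'a grid_fun \<Rightarrow> bool" where
  "even_ghosts K f \<longleftrightarrow>
     (\<forall>j\<in>{0..int K}. f (-1) j = f 0 j \<and> f (int K + 1) j = f (int K) j) \<and>
     (\<forall>i\<in>{0..int K}. f i (-1) = f i 0 \<and> f i (int K + 1) = f i (int K))"

definition odd_ghosts :: "nat \<Rightarrow> 'a::uminus grid_fun \<Rightarrow> bool" where
  "odd_ghosts K f \<longleftrightarrow>
     (\<forall>j\<in>{0..int K}. f (-1) j = - f 0 j \<and> f (int K + 1) j = - f (int K) j) \<and>
     (\<forall>i\<in>{0..int K}. f i (-1) = - f i 0 \<and> f i (int K + 1) = - f i (int K))"

section \<open>Difference operators with mesh size \<open>h\<close>\<close>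

definition grad_h :: "real \<Rightarrow> real grid_fun \<Rightarrow> (real ^ 2) grid_fun" where
  "grad_h h f i j =
     (1 / (2 * h)) *\<^sub>R vector [f (i + 1) j - f (i - 1) j, f i (j + 1) - f i (j - 1)]"

definition div_h :: "real \<Rightarrow> (real ^ 2) grid_fun \<Rightarrow> real grid_fun" where
  "div_h h f i j =
     1 / (2 * h) * (f (i + 1) j $ 1 - f (i - 1) j $ 1 + f i (j + 1) $ 2 - f i (j - 1) $ 2)"

definition lap_h :: "real \<Rightarrow> 'a::real_vector grid_fun \<Rightarrow> 'a grid_fun" where
  "lap_h h f i j =
     (1 / h\<^sup>2) *\<^sub>R (f (i + 1) j + f (i - 1) j + f i (j + 1) + f i (j - 1) - 4 *\<^sub>R f i j)"

text \<open>The discretisation of \<open>div (\<rho> v \<otimes> v)\<close>.\<close>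

definition conv_h :: "real \<Rightarrow> real grid_fun \<Rightarrow> (real ^ 2) grid_fun \<Rightarrow> (real ^ 2) grid_fun" where
  "conv_h h \<rho> v i j = (1 / (4 * h)) *\<^sub>R
     ((\<rho> i j * v i j $ 1 + \<rho> (i + 1) j * v (i + 1) j $ 1) *\<^sub>R (v i j + v (i + 1) j)
    - (\<rho> i j * v i j $ 1 + \<rho> (i - 1) j * v (i - 1) j $ 1) *\<^sub>R (v i j + v (i - 1) j)
    + (\<rho> i j * v i j $ 2 + \<rho> i (j + 1) * v i (j + 1) $ 2) *\<^sub>R (v i j + v i (j + 1))
    - (\<rho> i j * v i j $ 2 + \<rho> i (j - 1) * v i (j - 1) $ 2) *\<^sub>R (v i j + v i (j - 1)))"

section \<open>Energy density\<close>

definition C2_on :: "real set \<Rightarrow> (real \<Rightarrow> real) \<Rightarrow> bool" where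
  "C2_on S f \<longleftrightarrow>
     (\<forall>x\<in>S. f field_differentiable (at x)) \<and>
     (\<forall>x\<in>S. deriv f field_differentiable (at x)) \<and>
     continuous_on S (deriv (deriv f))"

definition strictly_convex_on :: "real set \<Rightarrow> (real \<Rightarrow> real) \<Rightarrow> bool" where
  "strictly_convex_on S f \<longleftrightarrow> convex S \<and>
     (\<forall>x\<in>S. \<forall>y\<in>S. \<forall>u\<in>{0<..<1}. x \<noteq> y \<longrightarrow>
        f ((1 - u) * x + u * y) < (1 - u) * f x + u * f y)"

definition double_well :: "(real \<Rightarrow> real) \<Rightarrow> bool" where
  "double_well W \<longleftrightarrow> C2_on {0<..} W \<and> (\<forall>x>0. W x \<ge> 0) \<and>
     (\<exists>\<alpha> \<beta>. 0 < \<alpha> \<and> \<alpha> < \<beta> \<and>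
        strictly_convex_on {0<..<\<alpha>} W \<and> strictly_convex_on {\<beta><..} W \<and>
        strictly_convex_on {\<alpha><..<\<beta>} (\<lambda>x. - W x))"

definition convex_splitting ::
    "(real \<Rightarrow> real) \<Rightarrow> (real \<Rightarrow> real) \<Rightarrow> (real \<Rightarrow> real) \<Rightarrow> bool" where
  "convex_splitting W U V \<longleftrightarrow>
     C2_on {0<..} U \<and> C2_on {0<..} V \<and> convex_on {0<..} U \<and> convex_on {0<..} V \<and>
     (\<forall>x>0. W x = U x - V x) \<and> (\<exists>\<kappa>>0. \<forall>x>0. deriv (deriv V) x \<ge> \<kappa>)"

section \<open>The scheme\<close>

definition time_grid :: "nat \<Rightarrow> real \<Rightarrow> (nat \<Rightarrow> real) \<Rightarrow> bool" where
  "time_grid N T t \<longleftrightarrow> t 0 = 0 \<and> t N = T \<and> (\<forall>n<N. t n < t (Suc n))"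

definition time_step :: "(nat \<Rightarrow> real) \<Rightarrow> nat \<Rightarrow> real" where
  "time_step t n = t (Suc n) - t n"

text \<open>
  Positivity of the density is part of the notion of solution because \<open>U\<close> and \<open>V\<close> are
  energy densities on the positive half-line. The potential \<open>\<Lambda>\<close> enters the scheme only at the
  time levels \<open>1, \<dots>, N\<close>. The argument \<open>\<mu> n\<close> is the artificial viscosity in time step \<open>n\<close>.
\<close>

definition scheme_solution ::
    "nat \<Rightarrow> nat \<Rightarrow> (nat \<Rightarrow> real) \<Rightarrow> real \<Rightarrow> (real \<Rightarrow> real) \<Rightarrow> (real \<Rightarrow> real) \<Rightarrow> (nat \<Rightarrow> real) \<Rightarrow> real \<Rightarrow>
     (nat \<Rightarrow> real grid_fun) \<Rightarrow> (nat \<Rightarrow> (real ^ 2) grid_fun) \<Rightarrow> (nat \<Rightarrow> real grid_fun) \<Rightarrow> bool" where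
  "scheme_solution K N t \<gamma> U V \<mu> M \<rho> v \<Lambda> \<longleftrightarrow>
     (\<forall>n\<le>N. even_ghosts K (\<rho> n) \<and> odd_ghosts K (v n)) \<and>
     (\<forall>n\<in>{1..N}. even_ghosts K (\<Lambda> n)) \<and>
     (\<forall>n\<le>N. \<forall>(i, j)\<in>grid K. \<rho> n i j > 0) \<and>
     (\<forall>n<N. \<forall>(i, j)\<in>grid K.
        \<rho> (Suc n) i j - \<rho> n i j
          + time_step t n * div_h (mesh K) (\<lambda>k l. \<rho> (Suc n) k l *\<^sub>R v (Suc n) k l) i j = 0 \<and>
        \<rho> (Suc n) i j *\<^sub>R v (Suc n) i j - \<rho> n i j *\<^sub>R v n i j
          + time_step t n *\<^sub>R conv_h (mesh K) (\<rho> n) (v n) i j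
          + (\<rho> n i j * (time_step t n / M\<^sup>2)) *\<^sub>R grad_h (mesh K) (\<Lambda> (Suc n)) i j
          - (\<mu> n * time_step t n) *\<^sub>R lap_h (mesh K) (v n) i j = 0 \<and>
        \<Lambda> (Suc n) i j - deriv U (\<rho> (Suc n) i j) + deriv V (\<rho> n i j)
          + \<gamma> * lap_h (mesh K) (\<rho> (Suc n)) i j = 0)"

end

theory Submission
  imports Defs
begin

text \<open>
  The scheme forces the leading-order density to stay at its initial value; after that the claim is
  an energy estimate for one explicit step of a discrete momentum equation with a fixed density.

  \<^bold>\<open>Limit.\<close> The \<open>1 / M\<^sup>2\<close> part of the momentum equation says that the leading potential has zero
  central-difference gradient. Because of the even ghost cells this makes it constant: the odd-even
  decoupling of central differences is broken at the boundary. In the potential equation,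
  monotonicity of \<open>U'\<close> then gives
  \<open>0 \<le> (const + \<gamma> \<Delta>\<delta>) \<delta>\<close> at every cell for the increment \<open>\<delta>\<close> of the leading density. Summed up, the
  constant disappears since mass is conserved, and \<open>\<Sum> \<delta> \<Delta>\<delta> \<ge> 0\<close> forces \<open>\<delta>\<close> to be constant, hence zero
  (\<open>density_preserved\<close>). So \<open>\<rho>\<close> keeps its value and \<open>\<rho> v\<close> is discretely divergence free at every time
  level, and the next order in the momentum equation gives one step with the pressure \<open>\<Lambda>\<^sub>1\<close>.

  \<^bold>\<open>Energy.\<close> Test that equation with the new velocity \<open>w = v + d\<close>. The pressure drops out by summation by
  parts. Convection tested with \<open>v\<close> vanishes, so only convection tested with \<open>d\<close> remains, and by the
  divergence constraint it contains only differences of \<open>v\<close> along grid edges. The viscosity dissipates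
  the squares of these differences. On each edge Young's inequality spends all of this dissipation on
  the convection term and on the mixed viscous term, leaving only multiples of \<open>|d|\<^sup>2\<close> at the end points
  (\<open>edge_estimate\<close>). These sum up to at most \<open>(2 R\<^sup>2 + 8) \<mu> \<tau> / h\<^sup>2 \<Sum> |d|\<^sup>2\<close> with \<open>R\<close> the maximum of the
  density, and the time step restriction makes that at most \<open>\<Sum> \<rho> |d|\<^sup>2\<close>, the gain from
  \<open>2 (w - v) \<bullet> w = |w|\<^sup>2 - |v|\<^sup>2 + |d|\<^sup>2\<close> (\<open>energy_step\<close>). The boundary terms are those of the viscosity at the
  odd ghost cells (\<open>boundary_terms\<close>).
\<close>

section \<open>Sums over grid lines\<close>

lemma sum_Icc_last:
  fixes f :: "int \<Rightarrow> 'a::ab_group_add"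
  shows "(\<Sum>i\<in>{0..int K}. f i) = (\<Sum>i\<in>{0..<int K}. f i) + f (int K)"
proof -
  have "{0..int K} = insert (int K) {0..<int K}" by auto
  then show ?thesis by (simp add: add.commute)
qed

lemma sum_Icc_first:
  fixes f :: "int \<Rightarrow> 'a::ab_group_add"
  shows "(\<Sum>i\<in>{0..int K}. f i) = f 0 + (\<Sum>i\<in>{0..<int K}. f (i + 1))"
proof -
  have "{0..int K} = insert 0 ((\<lambda>i. i + 1) ` {0..<int K})"
    by (auto simp: image_iff intro: bexI[of _ "x - 1" for x])
  moreover have "(0::int) \<notin> (\<lambda>i. i + 1) ` {0..<int K}" by auto
  moreover have "sum f ((\<lambda>i. i + 1) ` {0..<int K}) = (\<Sum>i\<in>{0..<int K}. f (i + 1))"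
    by (subst sum.reindex) (auto simp: inj_on_def)
  ultimately show ?thesis by (metis finite_atLeastLessThan_int finite_imageI sum.insert)
qed

text \<open>
  An edge \<open>(i, i + 1)\<close> meets the interval at its left end through \<open>a\<close> and at its right end through \<open>b\<close>.
  Regrouping by edges turns every summation by parts and every telescoping below into a
  pointwise identity plus two boundary terms.
\<close>

lemma sum_Icc_edges:
  fixes a b :: "int \<Rightarrow> 'a::ab_group_add"
  shows "(\<Sum>i\<in>{0..int K}. a i + b i)
    = (\<Sum>i\<in>{0..<int K}. a i + b (i + 1)) + a (int K) + b 0"
  unfolding sum.distrib sum_Icc_last[of a] sum_Icc_first[of b] by simp

lemma sum_grid_columns:
  "(\<Sum>(i, j)\<in>grid K. f i j) = (\<Sum>i\<in>{0..int K}. \<Sum>j\<in>{0..int K}. f i j)"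
  unfolding grid_def by (rule sum.cartesian_product[symmetric])

lemma sum_grid_rows:
  "(\<Sum>(i, j)\<in>grid K. f i j) = (\<Sum>j\<in>{0..int K}. \<Sum>i\<in>{0..int K}. f i j)"
  unfolding sum_grid_columns by (rule sum.swap)

lemma sum_grid_add:
  "(\<Sum>(i, j)\<in>grid K. f i j + g i j)
    = (\<Sum>(i, j)\<in>grid K. f i j) + (\<Sum>(i, j)\<in>grid K. (g i j :: 'a::comm_monoid_add))"
  by (simp add: case_prod_beta sum.distrib)

lemma finite_grid [simp]: "finite (grid K)"
  by (simp add: grid_def)

text \<open>
  The even ghosts of \<open>L\<close> and the odd ghosts of \<open>g\<close> make the boundary fluxes
  \<open>L(K+1) g(K) + L(K) g(K+1)\<close> cancel, so no boundary term survives.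
\<close>

lemma row_by_parts:
  fixes L g :: "int \<Rightarrow> real"
  assumes "L (-1) = L 0" "L (int K + 1) = L (int K)"
    and "g (-1) = - g 0" "g (int K + 1) = - g (int K)"
  shows "(\<Sum>i\<in>{0..int K}. (L (i + 1) - L (i - 1)) * g i + L i * (g (i + 1) - g (i - 1))) = 0"
proof -
  let ?a = "\<lambda>i. L (i + 1) * g i + L i * g (i + 1)"
  let ?b = "\<lambda>i. - (L (i - 1) * g i + L i * g (i - 1))"
  have "(\<Sum>i\<in>{0..int K}. (L (i + 1) - L (i - 1)) * g i + L i * (g (i + 1) - g (i - 1)))
      = (\<Sum>i\<in>{0..int K}. ?a i + ?b i)"
    by (intro sum.cong refl) (simp add: algebra_simps)
  also have "\<dots> = (\<Sum>i\<in>{0..<int K}. ?a i + ?b (i + 1)) + ?a (int K) + ?b 0"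
    by (rule sum_Icc_edges)
  also have "\<dots> = 0"
    using assms by (simp add: algebra_simps)
  finally show ?thesis .
qed

text \<open>
  The transport form of convection is skew-symmetric: each edge contributes the same number with
  opposite signs to its two end points.
\<close>

lemma row_flux_cancel:
  fixes H :: "int \<Rightarrow> real" and v :: "int \<Rightarrow> 'a::real_inner"
  assumes "H (-1) = 0" "H (int K) = 0"
  shows "(\<Sum>i\<in>{0..int K}. H i * (v (i + 1) \<bullet> v i) - H (i - 1) * (v (i - 1) \<bullet> v i)) = 0"
  using sum_Icc_edges[of "\<lambda>i. H i * (v (i + 1) \<bullet> v i)" "\<lambda>i. - (H (i - 1) * (v (i - 1) \<bullet> v i))" K]
  by (simp add: assms inner_commute)

lemma row_dirichlet:
  fixes f :: "int \<Rightarrow> real"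
  assumes "f (-1) = f 0" "f (int K + 1) = f (int K)"
  shows "(\<Sum>i\<in>{0..int K}. f i * (f (i + 1) + f (i - 1) - 2 * f i))
    = - (\<Sum>i\<in>{0..<int K}. (f (i + 1) - f i)\<^sup>2)"
proof -
  let ?a = "\<lambda>i. f i * (f (i + 1) - f i)" and ?b = "\<lambda>i. f i * (f (i - 1) - f i)"
  have "(\<Sum>i\<in>{0..int K}. f i * (f (i + 1) + f (i - 1) - 2 * f i))
      = (\<Sum>i\<in>{0..int K}. ?a i + ?b i)"
    by (intro sum.cong refl) (simp add: algebra_simps)
  also have "\<dots> = (\<Sum>i\<in>{0..<int K}. ?a i + ?b (i + 1)) + ?a (int K) + ?b 0"
    by (rule sum_Icc_edges)
  also have "\<dots> = (\<Sum>i\<in>{0..<int K}. - (f (i + 1) - f i)\<^sup>2)"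
    using assms by (simp add: algebra_simps power2_eq_square)
  finally show ?thesis by (simp add: sum_negf)
qed

text \<open>
  Here \<open>x\<close> is the difference of the old velocity along an edge and \<open>a\<close>, \<open>b\<close> are the increments at its
  end points. Of the dissipation \<open>2 l |x|\<^sup>2\<close>, one half is spent on the convective flux \<open>H\<close> and the
  other half on the mixed term \<open>x \<bullet> (b - a)\<close>.
\<close>

lemma edge_estimate:
  fixes x a b :: "'a::real_inner"
  assumes H: "\<bar>H\<bar> \<le> l * R" and "l \<ge> 0" "R \<ge> 0"
  shows "- 2 * l * (x \<bullet> (x + b - a)) - H * (x \<bullet> (a + b))
    \<le> l * (R\<^sup>2 / 2 + 2) * ((norm a)\<^sup>2 + (norm b)\<^sup>2)"
proof -
  have conv: "- H * (x \<bullet> (a + b)) \<le> l * ((norm x)\<^sup>2 + R\<^sup>2 / 4 * (norm (a + b))\<^sup>2)"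
  proof -
    have "- H * (x \<bullet> (a + b)) \<le> \<bar>H\<bar> * \<bar>x \<bullet> (a + b)\<bar>"
      by (metis abs_ge_self abs_minus_cancel abs_mult)
    also have "\<dots> \<le> (l * R) * (norm x * norm (a + b))"
      using H Cauchy_Schwarz_ineq2[of x "a + b"] by (intro mult_mono) (use assms in auto)
    also have "\<dots> = l * (norm x * (R * norm (a + b)))" by simp
    also have "\<dots> \<le> l * ((norm x)\<^sup>2 + R\<^sup>2 / 4 * (norm (a + b))\<^sup>2)"
    proof (rule mult_left_mono)
      have "0 \<le> (norm x - R * norm (a + b) / 2)\<^sup>2" by simp
      then show "norm x * (R * norm (a + b)) \<le> (norm x)\<^sup>2 + R\<^sup>2 / 4 * (norm (a + b))\<^sup>2"
        by (simp add: power2_diff power_mult_distrib power_divide)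
    qed fact
    finally show ?thesis .
  qed
  have "0 \<le> (norm (x + (b - a)))\<^sup>2" by simp
  then have "- 2 * (x \<bullet> (x + b - a)) \<le> - (norm x)\<^sup>2 + (norm (b - a))\<^sup>2"
    by (simp add: power2_norm_eq_inner algebra_simps inner_commute)
  from mult_left_mono[OF this \<open>l \<ge> 0\<close>]
  have visc: "- 2 * l * (x \<bullet> (x + b - a)) \<le> l * (- (norm x)\<^sup>2 + (norm (b - a))\<^sup>2)"
    by (simp add: algebra_simps)
  \<comment> \<open>Parallelogram law: it bounds both squares by the end point norms at once.\<close>
  have par: "(norm (a + b))\<^sup>2 + (norm (b - a))\<^sup>2 = 2 * ((norm a)\<^sup>2 + (norm b)\<^sup>2)"
    by (simp add: power2_norm_eq_inner algebra_simps inner_commute)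
  have "R\<^sup>2 / 4 * (norm (a + b))\<^sup>2 + (norm (b - a))\<^sup>2
      \<le> R\<^sup>2 / 4 * (2 * ((norm a)\<^sup>2 + (norm b)\<^sup>2)) + 2 * ((norm a)\<^sup>2 + (norm b)\<^sup>2)"
    unfolding par[symmetric] by (intro add_mono mult_left_mono) auto
  from mult_left_mono[OF this \<open>l \<ge> 0\<close>]
  have "l * (R\<^sup>2 / 4 * (norm (a + b))\<^sup>2 + (norm (b - a))\<^sup>2)
      \<le> l * (R\<^sup>2 / 2 + 2) * ((norm a)\<^sup>2 + (norm b)\<^sup>2)"
    by (simp add: algebra_simps)
  with conv visc show ?thesis by (simp add: algebra_simps)
qed

text \<open>
  One grid line of the viscous minus the convective part of the energy balance. \<open>H i\<close> is the scaled
  momentum flux through the edge \<open>(i, i + 1)\<close>; it vanishes at the boundary because the momentum is odd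
  there. In the Laplacian the odd ghosts leave \<open>-2 v \<bullet> (v + d)\<close> at both ends. Each point lies on at
  most two edges of its line, which doubles the constant of \<open>edge_estimate\<close>.
\<close>

lemma row_estimate:
  fixes v d :: "int \<Rightarrow> 'a::real_inner" and H :: "int \<Rightarrow> real"
  assumes v: "v (-1) = - v 0" "v (int K + 1) = - v (int K)"
    and H0: "H (-1) = 0" "H (int K) = 0"
    and H: "\<And>i. i \<in> {0..<int K} \<Longrightarrow> \<bar>H i\<bar> \<le> l * R"
    and l: "l \<ge> 0" and R: "R \<ge> 0"
  shows "(\<Sum>i\<in>{0..int K}. 2 * l * ((v (i + 1) + v (i - 1) - 2 *\<^sub>R v i) \<bullet> (v i + d i))
      - (H i *\<^sub>R (v (i + 1) - v i) + H (i - 1) *\<^sub>R (v i - v (i - 1))) \<bullet> d i)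
    \<le> l * (R\<^sup>2 + 4) * (\<Sum>i\<in>{0..int K}. (norm (d i))\<^sup>2)
      - 4 * l * (v 0 \<bullet> (v 0 + d 0) + v (int K) \<bullet> (v (int K) + d (int K)))" (is "?S \<le> ?B")
proof -
  define a where "a i = 2 * l * ((v (i + 1) - v i) \<bullet> (v i + d i)) - H i * ((v (i + 1) - v i) \<bullet> d i)" for i
  define b where "b i = - 2 * l * ((v i - v (i - 1)) \<bullet> (v i + d i))
      - H (i - 1) * ((v i - v (i - 1)) \<bullet> d i)" for i
  let ?D = "\<Sum>i\<in>{0..int K}. (norm (d i))\<^sup>2"
  have "?S = (\<Sum>i\<in>{0..int K}. a i + b i)"
    unfolding a_def b_def by (intro sum.cong refl) (simp add: algebra_simps)
  also have "\<dots> = (\<Sum>i\<in>{0..<int K}. a i + b (i + 1)) + a (int K) + b 0"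
    by (rule sum_Icc_edges)
  also have "a (int K) = - 4 * l * (v (int K) \<bullet> (v (int K) + d (int K)))"
    unfolding a_def v H0 by (simp add: algebra_simps)
  also have "b 0 = - 4 * l * (v 0 \<bullet> (v 0 + d 0))"
    unfolding b_def by (simp add: v H0 algebra_simps)
  also have "(\<Sum>i\<in>{0..<int K}. a i + b (i + 1)) \<le>
      (\<Sum>i\<in>{0..<int K}. l * (R\<^sup>2 / 2 + 2) * ((norm (d i))\<^sup>2 + (norm (d (i + 1)))\<^sup>2))"
  proof (rule sum_mono)
    fix i assume "i \<in> {0..<int K}"
    from edge_estimate[OF H[OF this] l R, of "v (i + 1) - v i" "d (i + 1)" "d i"]
    show "a i + b (i + 1) \<le> l * (R\<^sup>2 / 2 + 2) * ((norm (d i))\<^sup>2 + (norm (d (i + 1)))\<^sup>2)"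
      by (simp add: a_def b_def algebra_simps)
  qed
  also have "\<dots> = l * (R\<^sup>2 / 2 + 2) *
      ((\<Sum>i\<in>{0..<int K}. (norm (d i))\<^sup>2) + (\<Sum>i\<in>{0..<int K}. (norm (d (i + 1)))\<^sup>2))"
    by (simp add: sum_distrib_left sum.distrib distrib_left)
  also have "\<dots> \<le> l * (R\<^sup>2 / 2 + 2) * (?D + ?D)"
  proof (intro mult_left_mono add_mono)
    show "(\<Sum>i\<in>{0..<int K}. (norm (d i))\<^sup>2) \<le> ?D" by (simp add: sum_Icc_last)
    show "(\<Sum>i\<in>{0..<int K}. (norm (d (i + 1)))\<^sup>2) \<le> ?D" by (simp add: sum_Icc_first)
  qed (use l in auto)
  finally show ?thesis by (simp add: algebra_simps)
qed

section \<open>Summation by parts on the grid\<close>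

lemma gridD:
  assumes "(i, j) \<in> grid K"
  shows "i \<in> {0..int K}" "j \<in> {0..int K}"
  using assms by (auto simp: grid_def)

lemma even_ghostsD:
  assumes "even_ghosts K f"
  shows "j \<in> {0..int K} \<Longrightarrow> f (-1) j = f 0 j" "j \<in> {0..int K} \<Longrightarrow> f (int K + 1) j = f (int K) j"
    "i \<in> {0..int K} \<Longrightarrow> f i (-1) = f i 0" "i \<in> {0..int K} \<Longrightarrow> f i (int K + 1) = f i (int K)"
  using assms by (auto simp: even_ghosts_def)

lemma odd_ghostsD:
  assumes "odd_ghosts K f"
  shows "j \<in> {0..int K} \<Longrightarrow> f (-1) j = - f 0 j" "j \<in> {0..int K} \<Longrightarrow> f (int K + 1) j = - f (int K) j"
    "i \<in> {0..int K} \<Longrightarrow> f i (-1) = - f i 0" "i \<in> {0..int K} \<Longrightarrow> f i (int K + 1) = - f i (int K)"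
  using assms by (auto simp: odd_ghosts_def)

lemma odd_ghosts_scaleR:
  fixes v :: "(real ^ 2) grid_fun"
  assumes "even_ghosts K \<rho>" "odd_ghosts K v"
  shows "odd_ghosts K (\<lambda>i j. \<rho> i j *\<^sub>R v i j)"
  using assms unfolding even_ghosts_def odd_ghosts_def by auto

lemma inner_grad_h:
  "grad_h h f i j \<bullet> x =
     1 / (2 * h) * ((f (i + 1) j - f (i - 1) j) * x $ 1 + (f i (j + 1) - f i (j - 1)) * x $ 2)"
  by (simp add: grad_h_def inner_vec_def sum_2 distrib_left)

lemma grad_div_by_parts:
  assumes L: "even_ghosts K L" and g: "odd_ghosts K g"
  shows "(\<Sum>(i, j)\<in>grid K. grad_h h L i j \<bullet> g i j) = - (\<Sum>(i, j)\<in>grid K. L i j * div_h h g i j)"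
proof -
  have "(\<Sum>(i, j)\<in>grid K. grad_h h L i j \<bullet> g i j + L i j * div_h h g i j)
    = 1 / (2 * h) * (\<Sum>(i, j)\<in>grid K.
        ((L (i + 1) j - L (i - 1) j) * g i j $ 1 + L i j * (g (i + 1) j $ 1 - g (i - 1) j $ 1))
      + ((L i (j + 1) - L i (j - 1)) * g i j $ 2 + L i j * (g i (j + 1) $ 2 - g i (j - 1) $ 2)))"
    unfolding sum_distrib_left
    by (intro sum.cong refl) (auto simp: inner_grad_h div_h_def field_simps add_divide_distrib diff_divide_distrib)
  also have "\<dots> = 0"
  proof -
    have "(\<Sum>(i, j)\<in>grid K. (L (i + 1) j - L (i - 1) j) * g i j $ 1
        + L i j * (g (i + 1) j $ 1 - g (i - 1) j $ 1)) = 0"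
      unfolding sum_grid_rows
      by (intro sum.neutral ballI row_by_parts) (simp_all add: even_ghostsD[OF L] odd_ghostsD[OF g])
    moreover have "(\<Sum>(i, j)\<in>grid K. (L i (j + 1) - L i (j - 1)) * g i j $ 2
        + L i j * (g i (j + 1) $ 2 - g i (j - 1) $ 2)) = 0"
      unfolding sum_grid_columns
      by (intro sum.neutral ballI row_by_parts) (simp_all add: even_ghostsD[OF L] odd_ghostsD[OF g])
    ultimately show ?thesis by (simp add: sum_grid_add)
  qed
  finally show ?thesis by (simp add: sum_grid_add)
qed

text \<open>
  Total mass is conserved: this is summation by parts against the constant 1.
\<close>

lemma sum_div_h_zero:
  assumes "odd_ghosts K g"
  shows "(\<Sum>(i, j)\<in>grid K. div_h h g i j) = 0"
proof -
  have "even_ghosts K (\<lambda>_ _. 1 :: real)" by (simp add: even_ghosts_def)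
  from grad_div_by_parts[OF this assms, of h] show ?thesis
    by (simp add: grad_h_def inner_vec_def sum_2 sum.neutral case_prod_beta)
qed

lemma row_constant:
  fixes f :: "int \<Rightarrow> 'a"
  assumes "\<And>i. i \<in> {0..<int K} \<Longrightarrow> f (i + 1) = f i" "i \<in> {0..int K}"
  shows "f i = f 0"
proof -
  have "m \<le> K \<Longrightarrow> f (int m) = f 0" for m
  proof (induction m)
    case (Suc m)
    then show ?case using assms(1)[of "int m"] by (simp add: add.commute)
  qed simp
  from this[of "nat i"] assms(2) show ?thesis by auto
qed

lemma grid_constant:
  assumes "\<And>i j. i \<in> {0..<int K} \<Longrightarrow> j \<in> {0..int K} \<Longrightarrow> f (i + 1) j = f i j"
    and "\<And>i j. i \<in> {0..int K} \<Longrightarrow> j \<in> {0..<int K} \<Longrightarrow> f i (j + 1) = f i j"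
    and "(i, j) \<in> grid K"
  shows "f i j = f 0 0"
  using row_constant[of K "\<lambda>i. f i j" i] row_constant[of K "\<lambda>j. f 0 j" j] assms gridD[OF assms(3)]
  by auto

text \<open>
  For even ghosts \<open>h\<^sup>2 \<Sum> f \<Delta>f\<close> is minus the sum of the squared edge differences, so a nonnegative
  value forces all of them to vanish.
\<close>

lemma lap_nonneg_constant:
  fixes f :: "real grid_fun"
  assumes f: "even_ghosts K f" and h: "h > 0"
    and nonneg: "(\<Sum>(i, j)\<in>grid K. f i j * lap_h h f i j) \<ge> 0"
    and "(i, j) \<in> grid K"
  shows "f i j = f 0 0"
proof -
  let ?X = "\<Sum>j\<in>{0..int K}. \<Sum>i\<in>{0..<int K}. (f (i + 1) j - f i j)\<^sup>2"
  let ?Y = "\<Sum>i\<in>{0..int K}. \<Sum>j\<in>{0..<int K}. (f i (j + 1) - f i j)\<^sup>2"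
  have "(\<Sum>(i, j)\<in>grid K. f i j * lap_h h f i j) = 1 / h\<^sup>2 * (\<Sum>(i, j)\<in>grid K.
      f i j * (f (i + 1) j + f (i - 1) j - 2 * f i j)
      + f i j * (f i (j + 1) + f i (j - 1) - 2 * f i j))"
    unfolding sum_distrib_left
    by (intro sum.cong refl) (auto simp: lap_h_def field_simps add_divide_distrib diff_divide_distrib)
  also have "\<dots> = 1 / h\<^sup>2 * (- ?X - ?Y)"
  proof -
    have "(\<Sum>(i, j)\<in>grid K. f i j * (f (i + 1) j + f (i - 1) j - 2 * f i j)) = - ?X"
      unfolding sum_grid_rows
      by (subst sum_negf[symmetric], intro sum.cong refl row_dirichlet) (simp_all add: even_ghostsD[OF f])
    moreover have "(\<Sum>(i, j)\<in>grid K. f i j * (f i (j + 1) + f i (j - 1) - 2 * f i j)) = - ?Y"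
      unfolding sum_grid_columns
      by (subst sum_negf[symmetric], intro sum.cong refl row_dirichlet) (simp_all add: even_ghostsD[OF f])
    ultimately show ?thesis by (simp add: sum_grid_add)
  qed
  finally have "1 / h\<^sup>2 * (- ?X - ?Y) \<ge> 0" using nonneg by simp
  then have "- ?X - ?Y \<ge> 0" using h by (simp add: zero_le_mult_iff zero_le_divide_iff)
  moreover have "?X \<ge> 0" "?Y \<ge> 0" by (simp_all add: sum_nonneg)
  ultimately have X: "?X = 0" and Y: "?Y = 0" by linarith+
  show ?thesis
  proof (rule grid_constant[OF _ _ \<open>(i, j) \<in> grid K\<close>])
    show "f (i + 1) j = f i j" if "i \<in> {0..<int K}" "j \<in> {0..int K}" for i j
      using X that by (subst (asm) sum_nonneg_eq_0_iff) (auto simp: sum_nonneg sum_nonneg_eq_0_iff)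
    show "f i (j + 1) = f i j" if "i \<in> {0..int K}" "j \<in> {0..<int K}" for i j
      using Y that by (subst (asm) sum_nonneg_eq_0_iff) (auto simp: sum_nonneg sum_nonneg_eq_0_iff)
  qed
qed

text \<open>
  Central differences alone would only link cells of the same parity; the ghost condition
  \<open>f (-1) = f 0\<close> links the two classes.
\<close>

lemma row_central_constant:
  fixes f :: "int \<Rightarrow> 'a"
  assumes "f (-1) = f 0" "\<And>i. i \<in> {0..int K} \<Longrightarrow> f (i + 1) = f (i - 1)" "i \<in> {0..int K}"
  shows "f i = f 0"
proof -
  have "m \<le> K \<Longrightarrow> f (int m) = f 0 \<and> f (int m - 1) = f 0" for m
  proof (induction m)
    case (Suc m)
    then show ?case using assms(2)[of "int m"] by (simp add: add.commute)
  qed (use assms in simp)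
  from this[of "nat i"] assms(3) show ?thesis by auto
qed

lemma grad_zero_constant:
  assumes f: "even_ghosts K f" and h: "h > 0"
    and zero: "\<And>i j. (i, j) \<in> grid K \<Longrightarrow> grad_h h f i j = 0"
    and "(i, j) \<in> grid K"
  shows "f i j = f 0 0"
proof -
  have *: "f (k + 1) l = f (k - 1) l \<and> f k (l + 1) = f k (l - 1)" if "(k, l) \<in> grid K" for k l
    using zero[OF that] h by (auto simp: grad_h_def vec_eq_iff forall_2)
  have "f i j = f 0 j"
    by (rule row_central_constant[where K = K and f = "\<lambda>i. f i j"])
      (use * assms in \<open>auto simp: even_ghostsD[OF f] grid_def\<close>)
  also have "\<dots> = f 0 0"
    by (rule row_central_constant[where K = K])
      (use * assms in \<open>auto simp: even_ghostsD[OF f] grid_def\<close>)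
  finally show ?thesis .
qed

section \<open>The energy estimate for one step\<close>

text \<open>
  In the viscous term a corner occurs twice, once for each direction, whereas it is counted once in
  the sum over the boundary. Comparing both sides cell by cell, the second copy of
  \<open>- 4 (v \<bullet> w)\<close> at a corner is absorbed by completing a square: the right-hand side exceeds
  \<open>- 8 (v \<bullet> w)\<close> by \<open>|w + v|\<^sup>2 + 4 |v|\<^sup>2\<close>.
\<close>

lemma boundary_terms:
  fixes v w :: "(real ^ 2) grid_fun"
  assumes "K \<ge> 1"
  shows "- 4 * ((\<Sum>j\<in>{0..int K}. v 0 j \<bullet> w 0 j + v (int K) j \<bullet> w (int K) j)
        + (\<Sum>i\<in>{0..int K}. v i 0 \<bullet> w i 0 + v i (int K) \<bullet> w i (int K)))
    \<le> (\<Sum>(i, j)\<in>bdry K. (norm (w i j - v i j))\<^sup>2) + 4 * (\<Sum>(i, j)\<in>bdry K. v i j \<bullet> (v i j - w i j))"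
proof -
  \<comment> \<open>\<open>q i + q j\<close> is the number of ghost neighbours of the cell \<open>(i, j)\<close>.\<close>
  define q :: "int \<Rightarrow> real" where "q i = of_bool (i = 0) + of_bool (i = int K)" for i
  have q: "q i \<in> {0, 1}" "q i = 1 \<longleftrightarrow> i \<in> {0, int K}" for i
    using assms by (auto simp: q_def)
  have q_sum: "(\<Sum>i\<in>{0..int K}. q i * x i) = x 0 + x (int K)" for x :: "int \<Rightarrow> real"
    by (simp add: q_def distrib_right sum.distrib of_bool_def if_distrib[of "\<lambda>y. y * _"] cong: if_cong)
  have bdry: "(\<Sum>(i, j)\<in>bdry K. x i j)
      = (\<Sum>(i, j)\<in>grid K. if q i = 1 \<or> q j = 1 then x i j else 0)" for x :: "int \<Rightarrow> int \<Rightarrow> real"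
  proof -
    have "bdry K = {p \<in> grid K. q (fst p) = 1 \<or> q (snd p) = 1}"
      by (auto simp: bdry_def q)
    then show ?thesis by (simp add: sum.inter_filter case_prod_beta)
  qed
  have "- 4 * ((\<Sum>j\<in>{0..int K}. v 0 j \<bullet> w 0 j + v (int K) j \<bullet> w (int K) j)
        + (\<Sum>i\<in>{0..int K}. v i 0 \<bullet> w i 0 + v i (int K) \<bullet> w i (int K)))
      = - 4 * ((\<Sum>(i, j)\<in>grid K. q i * (v i j \<bullet> w i j)) + (\<Sum>(i, j)\<in>grid K. q j * (v i j \<bullet> w i j)))"
    by (subst sum_grid_rows, subst sum_grid_columns) (simp add: q_sum)
  also have "\<dots> = (\<Sum>(i, j)\<in>grid K. - 4 * (q i + q j) * (v i j \<bullet> w i j))"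
    by (simp add: case_prod_beta sum_distrib_left sum.distrib[symmetric] algebra_simps)
  also have "\<dots> \<le> (\<Sum>(i, j)\<in>grid K. if q i = 1 \<or> q j = 1
      then (norm (w i j - v i j))\<^sup>2 + 4 * (v i j \<bullet> (v i j - w i j)) else 0)"
  proof (intro sum_mono, clarify)
    fix i j
    let ?v = "v i j" and ?w = "w i j"
    have one: "- 4 * (?v \<bullet> ?w) \<le> (norm (?w - ?v))\<^sup>2 + 4 * (?v \<bullet> (?v - ?w))"
    proof -
      have "0 \<le> (norm (?w - ?v))\<^sup>2 + 4 * (norm ?v)\<^sup>2" by simp
      then show ?thesis by (simp add: power2_norm_eq_inner inner_diff_right)
    qed
    have two: "- 8 * (?v \<bullet> ?w) \<le> (norm (?w - ?v))\<^sup>2 + 4 * (?v \<bullet> (?v - ?w))"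
    proof -
      have "0 \<le> (norm (?w + ?v))\<^sup>2 + 4 * (norm ?v)\<^sup>2" by simp
      then show ?thesis
        by (simp add: power2_norm_eq_inner inner_diff_right inner_diff_left inner_add_left
            inner_add_right inner_commute)
    qed
    show "- 4 * (q i + q j) * (?v \<bullet> ?w) \<le> (if q i = 1 \<or> q j = 1
      then (norm (?w - ?v))\<^sup>2 + 4 * (?v \<bullet> (?v - ?w)) else 0)"
      using one two q(1)[of i] q(1)[of j] by auto
  qed
  also have "\<dots> = (\<Sum>(i, j)\<in>bdry K. (norm (w i j - v i j))\<^sup>2 + 4 * (v i j \<bullet> (v i j - w i j)))"
    by (simp add: bdry)
  also have "\<dots> = (\<Sum>(i, j)\<in>bdry K. (norm (w i j - v i j))\<^sup>2) + 4 * (\<Sum>(i, j)\<in>bdry K. v i j \<bullet> (v i j - w i j))"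
    by (simp add: case_prod_beta sum.distrib sum_distrib_left)
  finally show ?thesis .
qed

text \<open>
  One step with a fixed density. With \<open>l = \<mu> \<tau> / h\<^sup>2 = m \<tau> / h\<close>, the scaled fluxes
  \<open>\<tau> / (2 h) (\<rho> v + \<rho> v)\<close> are at most \<open>l R\<close>, which is how the artificial viscosity
  \<open>\<mu> = h m\<close> matches the convection: both carry the same factor \<open>l\<close> in \<open>row_estimate\<close>.
\<close>

lemma energy_step:
  fixes \<rho> L :: "real grid_fun" and v w :: "(real ^ 2) grid_fun"
  assumes "K \<ge> 1" and h: "h > 0" and "\<tau> \<ge> 0" "m \<ge> 0" "R \<ge> 0" and \<mu>: "\<mu> = h * m"
    and \<rho>: "even_ghosts K \<rho>" and L: "even_ghosts K L"
    and v: "odd_ghosts K v" and w: "odd_ghosts K w"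
    and div_v: "\<And>i j. (i, j) \<in> grid K \<Longrightarrow> div_h h (\<lambda>k l. \<rho> k l *\<^sub>R v k l) i j = 0"
    and div_w: "\<And>i j. (i, j) \<in> grid K \<Longrightarrow> div_h h (\<lambda>k l. \<rho> k l *\<^sub>R w k l) i j = 0"
    and momentum: "\<And>i j. (i, j) \<in> grid K \<Longrightarrow>
      \<rho> i j *\<^sub>R w i j - \<rho> i j *\<^sub>R v i j + \<tau> *\<^sub>R conv_h h \<rho> v i j
        + (\<rho> i j * \<tau>) *\<^sub>R grad_h h L i j - (\<mu> * \<tau>) *\<^sub>R lap_h h v i j = 0"
    and \<rho>_R: "\<And>i j. (i, j) \<in> grid K \<Longrightarrow> \<bar>\<rho> i j\<bar> \<le> R"
    and v_m: "\<And>i j. (i, j) \<in> grid K \<Longrightarrow> norm (v i j) \<le> m"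
    and cfl: "\<And>i j. (i, j) \<in> grid K \<Longrightarrow> \<mu> * \<tau> / h\<^sup>2 * (2 * R\<^sup>2 + 8) \<le> \<rho> i j"
  shows "(\<Sum>(i, j)\<in>grid K. \<rho> i j * (norm (w i j))\<^sup>2) \<le> (\<Sum>(i, j)\<in>grid K. \<rho> i j * (norm (v i j))\<^sup>2)
      + \<mu> * \<tau> / h\<^sup>2 * (\<Sum>(i, j)\<in>bdry K. (norm (w i j - v i j))\<^sup>2)
      + 4 * (\<mu> * \<tau> / h\<^sup>2) * (\<Sum>(i, j)\<in>bdry K. v i j \<bullet> (v i j - w i j))"
proof -
  define l where "l = \<mu> * \<tau> / h\<^sup>2"
  define d where "d i j = w i j - v i j" for i j
  define A where "A i j = \<tau> / (2 * h) * (\<rho> i j * v i j $ 1 + \<rho> (i + 1) j * v (i + 1) j $ 1)" for i j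
  define B where "B i j = \<tau> / (2 * h) * (\<rho> i j * v i j $ 2 + \<rho> i (j + 1) * v i (j + 1) $ 2)" for i j
  define E1 where "E1 i j = 2 * l * ((v (i + 1) j + v (i - 1) j - 2 *\<^sub>R v i j) \<bullet> (v i j + d i j))
      - (A i j *\<^sub>R (v (i + 1) j - v i j) + A (i - 1) j *\<^sub>R (v i j - v (i - 1) j)) \<bullet> d i j" for i j
  define E2 where "E2 i j = 2 * l * ((v i (j + 1) + v i (j - 1) - 2 *\<^sub>R v i j) \<bullet> (v i j + d i j))
      - (B i j *\<^sub>R (v i (j + 1) - v i j) + B i (j - 1) *\<^sub>R (v i j - v i (j - 1))) \<bullet> d i j" for i j
  define Q1 where "Q1 i j = A i j * (v (i + 1) j \<bullet> v i j) - A (i - 1) j * (v (i - 1) j \<bullet> v i j)" for i j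
  define Q2 where "Q2 i j = B i j * (v i (j + 1) \<bullet> v i j) - B i (j - 1) * (v i (j - 1) \<bullet> v i j)" for i j
  have l: "l = m * \<tau> / h" using h by (simp add: l_def \<mu> power2_eq_square)
  have l0: "l \<ge> 0" using assms by (simp add: l)
  have pointwise: "\<rho> i j * (norm (w i j))\<^sup>2 - \<rho> i j * (norm (v i j))\<^sup>2 + \<rho> i j * (norm (d i j))\<^sup>2
      = (E1 i j + E2 i j) - (Q1 i j + Q2 i j) - 2 * \<tau> * (grad_h h L i j \<bullet> (\<rho> i j *\<^sub>R w i j))"
    if ij: "(i, j) \<in> grid K" for i j
  proof -
    have div0: "A i j - A (i - 1) j + B i j - B i (j - 1) = 0"
    proof -
      have "A i j - A (i - 1) j + B i j - B i (j - 1) = \<tau> * div_h h (\<lambda>k l. \<rho> k l *\<^sub>R v k l) i j"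
        by (simp add: A_def B_def div_h_def algebra_simps)
      then show ?thesis using div_v[OF ij] by simp
    qed
    have conv0: "(2 * \<tau>) *\<^sub>R conv_h h \<rho> v i j =
        A i j *\<^sub>R (v i j + v (i + 1) j) - A (i - 1) j *\<^sub>R (v i j + v (i - 1) j)
      + B i j *\<^sub>R (v i j + v i (j + 1)) - B i (j - 1) *\<^sub>R (v i j + v i (j - 1))"
    proof -
      have scale: "(2 * \<tau>) *\<^sub>R (1 / (4 * h)) *\<^sub>R (a *\<^sub>R x - b *\<^sub>R y + c *\<^sub>R z - e *\<^sub>R u)
        = (\<tau> / (2 * h) * a) *\<^sub>R x - (\<tau> / (2 * h) * b) *\<^sub>R y
          + (\<tau> / (2 * h) * c) *\<^sub>R z - (\<tau> / (2 * h) * e) *\<^sub>R u"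
        for a b c e and x y z u :: "real ^ 2"
        by (simp add: scaleR_add_right scaleR_diff_right)
      show ?thesis
        unfolding conv_h_def scale A_def B_def by (simp add: add.commute)
    qed
    \<comment> \<open>In the transport form the constraint removes the terms \<open>|v|\<^sup>2\<close>, and what is left telescopes.\<close>
    have conv_v: "2 * \<tau> * (conv_h h \<rho> v i j \<bullet> v i j) = Q1 i j + Q2 i j"
    proof -
      have "2 * \<tau> * (conv_h h \<rho> v i j \<bullet> v i j) = ((2 * \<tau>) *\<^sub>R conv_h h \<rho> v i j) \<bullet> v i j" by simp
      also have "\<dots> = Q1 i j + Q2 i j + (A i j - A (i - 1) j + B i j - B i (j - 1)) * (v i j \<bullet> v i j)"
        unfolding conv0 Q1_def Q2_def by (simp add: inner_add_left inner_diff_left algebra_simps)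
      finally show ?thesis using div0 by simp
    qed
    \<comment> \<open>In the difference form it removes twice as much, and only edge differences of \<open>v\<close> remain.\<close>
    have conv_d: "2 * \<tau> * (conv_h h \<rho> v i j \<bullet> d i j) =
       (A i j *\<^sub>R (v (i + 1) j - v i j) + A (i - 1) j *\<^sub>R (v i j - v (i - 1) j)) \<bullet> d i j
     + (B i j *\<^sub>R (v i (j + 1) - v i j) + B i (j - 1) *\<^sub>R (v i j - v i (j - 1))) \<bullet> d i j" (is "_ = ?C")
    proof -
      have "2 * \<tau> * (conv_h h \<rho> v i j \<bullet> d i j) = ((2 * \<tau>) *\<^sub>R conv_h h \<rho> v i j) \<bullet> d i j" by simp
      also have "\<dots> = ?C + 2 * (A i j - A (i - 1) j + B i j - B i (j - 1)) * (v i j \<bullet> d i j)"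
        unfolding conv0 by (simp add: inner_add_left inner_diff_left algebra_simps)
      finally show ?thesis using div0 by simp
    qed
    have wd: "w i j = v i j + d i j" by (simp add: d_def)
    have visc: "2 * \<mu> * \<tau> * (lap_h h v i j \<bullet> w i j)
      = 2 * l * ((v (i + 1) j + v (i - 1) j - 2 *\<^sub>R v i j) \<bullet> (v i j + d i j))
      + 2 * l * ((v i (j + 1) + v i (j - 1) - 2 *\<^sub>R v i j) \<bullet> (v i j + d i j))"
    proof -
      have "2 * \<mu> * \<tau> * (lap_h h v i j \<bullet> w i j) = 2 * l *
        ((v (i + 1) j + v (i - 1) j + v i (j + 1) + v i (j - 1) - 4 *\<^sub>R v i j) \<bullet> w i j)"
        by (simp add: lap_h_def l_def)
      also have "v (i + 1) j + v (i - 1) j + v i (j + 1) + v i (j - 1) - 4 *\<^sub>R v i j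
        = (v (i + 1) j + v (i - 1) j - 2 *\<^sub>R v i j) + (v i (j + 1) + v i (j - 1) - 2 *\<^sub>R v i j)"
        using scaleR_left_distrib[of 2 2 "v i j"] by simp
      finally show ?thesis unfolding wd[symmetric] by (simp only: inner_add_left distrib_left)
    qed
    \<comment> \<open>The momentum equation tested with \<open>2 w\<close>.\<close>
    have "0 = 2 * ((\<rho> i j *\<^sub>R w i j - \<rho> i j *\<^sub>R v i j + \<tau> *\<^sub>R conv_h h \<rho> v i j
        + (\<rho> i j * \<tau>) *\<^sub>R grad_h h L i j - (\<mu> * \<tau>) *\<^sub>R lap_h h v i j) \<bullet> w i j)"
      by (simp add: momentum[OF ij])
    also have "\<dots> = 2 * \<rho> i j * (w i j \<bullet> w i j) - 2 * \<rho> i j * (v i j \<bullet> w i j)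
        + 2 * \<tau> * (conv_h h \<rho> v i j \<bullet> w i j) + 2 * \<tau> * (grad_h h L i j \<bullet> (\<rho> i j *\<^sub>R w i j))
        - 2 * \<mu> * \<tau> * (lap_h h v i j \<bullet> w i j)"
      by (simp add: inner_add_left inner_diff_left algebra_simps)
    finally have *: "2 * \<rho> i j * (w i j \<bullet> w i j) - 2 * \<rho> i j * (v i j \<bullet> w i j)
        = 2 * \<mu> * \<tau> * (lap_h h v i j \<bullet> w i j) - 2 * \<tau> * (conv_h h \<rho> v i j \<bullet> w i j)
          - 2 * \<tau> * (grad_h h L i j \<bullet> (\<rho> i j *\<^sub>R w i j))" by linarith
    have "2 * \<tau> * (conv_h h \<rho> v i j \<bullet> w i j)
        = 2 * \<tau> * (conv_h h \<rho> v i j \<bullet> v i j) + 2 * \<tau> * (conv_h h \<rho> v i j \<bullet> d i j)"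
      unfolding wd by (simp add: inner_add_right distrib_left)
    moreover have "\<rho> i j * (norm (w i j))\<^sup>2 - \<rho> i j * (norm (v i j))\<^sup>2 + \<rho> i j * (norm (d i j))\<^sup>2
        = 2 * \<rho> i j * (w i j \<bullet> w i j) - 2 * \<rho> i j * (v i j \<bullet> w i j)"
      by (simp add: d_def power2_norm_eq_inner inner_diff_left inner_diff_right inner_commute algebra_simps)
    ultimately show ?thesis
      using * unfolding visc conv_v conv_d E1_def E2_def by linarith
  qed
  have A0: "A (-1) j = 0" "A (int K) j = 0" if "j \<in> {0..int K}" for j
    using that by (simp_all add: A_def even_ghostsD[OF \<rho>] odd_ghostsD[OF v])
  have B0: "B i (-1) = 0" "B i (int K) = 0" if "i \<in> {0..int K}" for i
    using that by (simp_all add: B_def even_ghostsD[OF \<rho>] odd_ghostsD[OF v])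
  have Q1: "(\<Sum>(i, j)\<in>grid K. Q1 i j) = 0"
    unfolding sum_grid_rows Q1_def by (intro sum.neutral ballI row_flux_cancel A0)
  have Q2: "(\<Sum>(i, j)\<in>grid K. Q2 i j) = 0"
    unfolding sum_grid_columns Q2_def by (intro sum.neutral ballI row_flux_cancel B0)
  have press: "(\<Sum>(i, j)\<in>grid K. grad_h h L i j \<bullet> (\<rho> i j *\<^sub>R w i j)) = 0"
    using grad_div_by_parts[OF L odd_ghosts_scaleR[OF \<rho> w], of h] div_w
    by (simp add: case_prod_beta sum.neutral)
  have flux: "\<bar>\<tau> / (2 * h) * (\<rho> i j * v i j $ k + \<rho> i' j' * v i' j' $ k)\<bar> \<le> l * R"
    if "(i, j) \<in> grid K" "(i', j') \<in> grid K" for i j i' j' k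
  proof -
    have b: "\<bar>\<rho> i j * v i j $ k\<bar> \<le> R * m" if "(i, j) \<in> grid K" for i j
      unfolding abs_mult
      using \<rho>_R[OF that] order_trans[OF component_le_norm_cart v_m[OF that]] \<open>R \<ge> 0\<close>
      by (intro mult_mono) auto
    have "\<bar>\<rho> i j * v i j $ k + \<rho> i' j' * v i' j' $ k\<bar> \<le> 2 * R * m"
      using b[OF that(1)] b[OF that(2)] by linarith
    from mult_left_mono[OF this, of "\<tau> / (2 * h)"]
    have "\<tau> / (2 * h) * \<bar>\<rho> i j * v i j $ k + \<rho> i' j' * v i' j' $ k\<bar> \<le> l * R"
      using h \<open>\<tau> \<ge> 0\<close> by (simp add: l mult.commute mult.left_commute)
    then show ?thesis using h \<open>\<tau> \<ge> 0\<close> by (simp add: abs_mult)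
  qed
  have E1: "(\<Sum>(i, j)\<in>grid K. E1 i j) \<le> l * (R\<^sup>2 + 4) * (\<Sum>(i, j)\<in>grid K. (norm (d i j))\<^sup>2)
      - 4 * l * (\<Sum>j\<in>{0..int K}. v 0 j \<bullet> w 0 j + v (int K) j \<bullet> w (int K) j)"
  proof -
    have "(\<Sum>(i, j)\<in>grid K. E1 i j) \<le> (\<Sum>j\<in>{0..int K}. l * (R\<^sup>2 + 4) * (\<Sum>i\<in>{0..int K}. (norm (d i j))\<^sup>2)
        - 4 * l * (v 0 j \<bullet> (v 0 j + d 0 j) + v (int K) j \<bullet> (v (int K) j + d (int K) j)))"
      unfolding sum_grid_rows E1_def
    proof (intro sum_mono row_estimate l0 \<open>R \<ge> 0\<close>)
      show "\<bar>A i j\<bar> \<le> l * R" if "j \<in> {0..int K}" "i \<in> {0..<int K}" for i j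
        unfolding A_def using that by (intro flux) (auto simp: grid_def)
    qed (simp_all add: A0 odd_ghostsD[OF v])
    then show ?thesis
      by (simp add: sum_grid_rows d_def sum_subtractf sum_distrib_left)
  qed
  have E2: "(\<Sum>(i, j)\<in>grid K. E2 i j) \<le> l * (R\<^sup>2 + 4) * (\<Sum>(i, j)\<in>grid K. (norm (d i j))\<^sup>2)
      - 4 * l * (\<Sum>i\<in>{0..int K}. v i 0 \<bullet> w i 0 + v i (int K) \<bullet> w i (int K))"
  proof -
    have "(\<Sum>(i, j)\<in>grid K. E2 i j) \<le> (\<Sum>i\<in>{0..int K}. l * (R\<^sup>2 + 4) * (\<Sum>j\<in>{0..int K}. (norm (d i j))\<^sup>2)
        - 4 * l * (v i 0 \<bullet> (v i 0 + d i 0) + v i (int K) \<bullet> (v i (int K) + d i (int K))))"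
      unfolding sum_grid_columns E2_def
    proof (intro sum_mono row_estimate l0 \<open>R \<ge> 0\<close>)
      show "\<bar>B i j\<bar> \<le> l * R" if "i \<in> {0..int K}" "j \<in> {0..<int K}" for i j
        unfolding B_def using that by (intro flux) (auto simp: grid_def)
    qed (simp_all add: B0 odd_ghostsD[OF v])
    then show ?thesis
      by (simp add: sum_grid_columns d_def sum_subtractf sum_distrib_left)
  qed
  have "(\<Sum>(i, j)\<in>grid K. \<rho> i j * (norm (w i j))\<^sup>2) - (\<Sum>(i, j)\<in>grid K. \<rho> i j * (norm (v i j))\<^sup>2)
      + (\<Sum>(i, j)\<in>grid K. \<rho> i j * (norm (d i j))\<^sup>2)
    = (\<Sum>(i, j)\<in>grid K. \<rho> i j * (norm (w i j))\<^sup>2 - \<rho> i j * (norm (v i j))\<^sup>2 + \<rho> i j * (norm (d i j))\<^sup>2)"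
    by (simp add: case_prod_beta sum.distrib sum_subtractf)
  also have "\<dots> = (\<Sum>(i, j)\<in>grid K. (E1 i j + E2 i j) - (Q1 i j + Q2 i j)
      - 2 * \<tau> * (grad_h h L i j \<bullet> (\<rho> i j *\<^sub>R w i j)))"
    by (intro sum.cong refl) (clarify, rule pointwise)
  also have "\<dots> = (\<Sum>(i, j)\<in>grid K. E1 i j) + (\<Sum>(i, j)\<in>grid K. E2 i j)
      - ((\<Sum>(i, j)\<in>grid K. Q1 i j) + (\<Sum>(i, j)\<in>grid K. Q2 i j))
      - 2 * \<tau> * (\<Sum>(i, j)\<in>grid K. grad_h h L i j \<bullet> (\<rho> i j *\<^sub>R w i j))"
    by (simp add: case_prod_beta sum.distrib sum_subtractf sum_distrib_left)
  finally have balance: "(\<Sum>(i, j)\<in>grid K. \<rho> i j * (norm (w i j))\<^sup>2) - (\<Sum>(i, j)\<in>grid K. \<rho> i j * (norm (v i j))\<^sup>2)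
      + (\<Sum>(i, j)\<in>grid K. \<rho> i j * (norm (d i j))\<^sup>2)
    = (\<Sum>(i, j)\<in>grid K. E1 i j) + (\<Sum>(i, j)\<in>grid K. E2 i j)"
    by (simp only: Q1 Q2 press)
  have absorb: "l * (2 * R\<^sup>2 + 8) * (\<Sum>(i, j)\<in>grid K. (norm (d i j))\<^sup>2)
      \<le> (\<Sum>(i, j)\<in>grid K. \<rho> i j * (norm (d i j))\<^sup>2)"
    unfolding sum_distrib_left
    by (intro sum_mono) (auto simp del: times_divide_eq_left intro!: mult_right_mono cfl[folded l_def])
  have "l * (- 4 * ((\<Sum>j\<in>{0..int K}. v 0 j \<bullet> w 0 j + v (int K) j \<bullet> w (int K) j)
        + (\<Sum>i\<in>{0..int K}. v i 0 \<bullet> w i 0 + v i (int K) \<bullet> w i (int K))))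
    \<le> l * ((\<Sum>(i, j)\<in>bdry K. (norm (w i j - v i j))\<^sup>2) + 4 * (\<Sum>(i, j)\<in>bdry K. v i j \<bullet> (v i j - w i j)))"
    by (intro mult_left_mono boundary_terms l0 \<open>K \<ge> 1\<close>)
  with E1 E2 balance absorb show ?thesis
    unfolding l_def[symmetric] by (simp add: algebra_simps)
qed

section \<open>Limits of grid functions and of difference operators\<close>

text \<open>
  The ghost conditions express a ghost value by the value at the nearest grid point, whose index is
  found by clamping.
\<close>

definition clamp_index :: "nat \<Rightarrow> int \<Rightarrow> int" where
  "clamp_index K i = max 0 (min (int K) i)"

text \<open>
  The four corner ghosts are left out: the boundary conditions do not determine them and the
  difference operators do not read them.
\<close>

definition ghost_grid :: "nat \<Rightarrow> (int \<times> int) set" where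
  "ghost_grid K = {-1..int K + 1} \<times> {0..int K} \<union> {0..int K} \<times> {-1..int K + 1}"

lemma clamp_index_grid: "(clamp_index K i, clamp_index K j) \<in> grid K"
  by (auto simp: clamp_index_def grid_def)

lemma clamp_index_id [simp]: "i \<in> {0..int K} \<Longrightarrow> clamp_index K i = i"
  by (auto simp: clamp_index_def)

text \<open>
  Every grid function extends from the grid to even ghosts. This supplies ghost values for the
  coefficients in the expansion of the potential, which are given on the grid only.
\<close>

lemma even_ghosts_clamp_index: "even_ghosts K (\<lambda>i j. f (clamp_index K i) (clamp_index K j))"
  by (simp add: even_ghosts_def clamp_index_def)

lemma neighbours_in_ghost_grid:
  assumes "(i, j) \<in> grid K"
  shows "(i, j) \<in> ghost_grid K" "(i + 1, j) \<in> ghost_grid K" "(i - 1, j) \<in> ghost_grid K"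
    "(i, j + 1) \<in> ghost_grid K" "(i, j - 1) \<in> ghost_grid K"
  using assms by (auto simp: grid_def ghost_grid_def)

lemma ghost_grid_cases:
  assumes "(i, j) \<in> ghost_grid K"
  obtains "(i, j) \<in> grid K" | "i = -1" "j \<in> {0..int K}" | "i = int K + 1" "j \<in> {0..int K}"
    | "j = -1" "i \<in> {0..int K}" | "j = int K + 1" "i \<in> {0..int K}"
proof -
  have "(i, j) \<in> grid K \<or> (i = -1 \<and> j \<in> {0..int K}) \<or> (i = int K + 1 \<and> j \<in> {0..int K})
      \<or> (j = -1 \<and> i \<in> {0..int K}) \<or> (j = int K + 1 \<and> i \<in> {0..int K})"
    using assms by (auto simp: ghost_grid_def grid_def)
  then show ?thesis using that by blast
qed

lemma even_ghosts_value:
  assumes "even_ghosts K f" "(i, j) \<in> ghost_grid K"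
  shows "f i j = f (clamp_index K i) (clamp_index K j)"
  using assms(2)
  by (cases rule: ghost_grid_cases) (auto simp: clamp_index_def grid_def even_ghostsD[OF assms(1)])

lemma odd_ghosts_value:
  fixes f :: "'a::group_add grid_fun"
  assumes "odd_ghosts K f" "(i, j) \<in> ghost_grid K" "(i, j) \<notin> grid K"
  shows "f i j = - f (clamp_index K i) (clamp_index K j)"
  using assms(2)
  by (cases rule: ghost_grid_cases) (use assms(3) in \<open>auto simp: clamp_index_def odd_ghostsD[OF assms(1)]\<close>)

lemma even_ghosts_tendsto:
  assumes ev: "\<forall>\<^sub>F M in F. even_ghosts K (f M)" and g: "even_ghosts K g"
    and lim: "\<And>i j. (i, j) \<in> grid K \<Longrightarrow> ((\<lambda>M. f M i j) \<longlongrightarrow> g i j) F"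
    and ij: "(i, j) \<in> ghost_grid K"
  shows "((\<lambda>M. f M i j) \<longlongrightarrow> g i j) F"
proof -
  have "\<forall>\<^sub>F M in F. f M (clamp_index K i) (clamp_index K j) = f M i j"
    using ev by eventually_elim (rule even_ghosts_value[OF _ ij, symmetric])
  moreover have "((\<lambda>M. f M (clamp_index K i) (clamp_index K j)) \<longlongrightarrow> g i j) F"
    unfolding even_ghosts_value[OF g ij] by (rule lim[OF clamp_index_grid])
  ultimately show ?thesis by (rule Lim_transform_eventually[rotated])
qed

lemma odd_ghosts_tendsto:
  fixes g :: "'a::real_normed_vector grid_fun"
  assumes ev: "\<forall>\<^sub>F M in F. odd_ghosts K (f M)" and g: "odd_ghosts K g"
    and lim: "\<And>i j. (i, j) \<in> grid K \<Longrightarrow> ((\<lambda>M. f M i j) \<longlongrightarrow> g i j) F"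
    and ij: "(i, j) \<in> ghost_grid K"
  shows "((\<lambda>M. f M i j) \<longlongrightarrow> g i j) F"
proof (cases "(i, j) \<in> grid K")
  case False
  have "\<forall>\<^sub>F M in F. - f M (clamp_index K i) (clamp_index K j) = f M i j"
    using ev by eventually_elim (rule odd_ghosts_value[OF _ ij False, symmetric])
  moreover have "((\<lambda>M. - f M (clamp_index K i) (clamp_index K j)) \<longlongrightarrow> g i j) F"
    unfolding odd_ghosts_value[OF g ij False] by (intro tendsto_minus lim[OF clamp_index_grid])
  ultimately show ?thesis by (rule Lim_transform_eventually[rotated])
qed (rule lim)

lemma tendsto_grad_h:
  assumes "\<And>i j. (i, j) \<in> ghost_grid K \<Longrightarrow> ((\<lambda>M. f M i j) \<longlongrightarrow> g i j) F" and "(i, j) \<in> grid K"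
  shows "((\<lambda>M. grad_h h (f M) i j) \<longlongrightarrow> grad_h h g i j) F"
proof (rule vec_tendstoI)
  fix k :: 2
  have "((\<lambda>M. 1 / (2 * h) * (f M (i + 1) j - f M (i - 1) j))
      \<longlongrightarrow> 1 / (2 * h) * (g (i + 1) j - g (i - 1) j)) F"
    "((\<lambda>M. 1 / (2 * h) * (f M i (j + 1) - f M i (j - 1)))
      \<longlongrightarrow> 1 / (2 * h) * (g i (j + 1) - g i (j - 1))) F"
    by (intro tendsto_intros assms(1) neighbours_in_ghost_grid[OF assms(2)])+
  then show "((\<lambda>M. grad_h h (f M) i j $ k) \<longlongrightarrow> grad_h h g i j $ k) F"
    using exhaust_2[of k] by (auto simp: grad_h_def)
qed

lemma tendsto_div_h:
  assumes "\<And>i j. (i, j) \<in> ghost_grid K \<Longrightarrow> ((\<lambda>M. f M i j) \<longlongrightarrow> g i j) F" and "(i, j) \<in> grid K"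
  shows "((\<lambda>M. div_h h (f M) i j) \<longlongrightarrow> div_h h g i j) F"
  unfolding div_h_def by (intro tendsto_intros assms(1) neighbours_in_ghost_grid[OF assms(2)])

lemma tendsto_lap_h:
  fixes g :: "'a::real_normed_vector grid_fun"
  assumes "\<And>i j. (i, j) \<in> ghost_grid K \<Longrightarrow> ((\<lambda>M. f M i j) \<longlongrightarrow> g i j) F" and "(i, j) \<in> grid K"
  shows "((\<lambda>M. lap_h h (f M) i j) \<longlongrightarrow> lap_h h g i j) F"
  unfolding lap_h_def by (intro tendsto_intros assms(1) neighbours_in_ghost_grid[OF assms(2)])

lemma tendsto_conv_h:
  assumes "\<And>i j. (i, j) \<in> ghost_grid K \<Longrightarrow> ((\<lambda>M. r M i j) \<longlongrightarrow> \<rho> i j) F"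
    and "\<And>i j. (i, j) \<in> ghost_grid K \<Longrightarrow> ((\<lambda>M. f M i j) \<longlongrightarrow> v i j) F" and "(i, j) \<in> grid K"
  shows "((\<lambda>M. conv_h h (r M) (f M) i j) \<longlongrightarrow> conv_h h \<rho> v i j) F"
  unfolding conv_h_def by (intro tendsto_intros assms(1,2) neighbours_in_ghost_grid[OF assms(3)])

text \<open>
  This is how an equation of the scheme is passed to the limit.
\<close>

lemma tendsto_eventually_zero:
  fixes f :: "'a \<Rightarrow> 'b::{t2_space, zero}"
  assumes "F \<noteq> bot" "(f \<longlongrightarrow> l) F" "\<forall>\<^sub>F x in F. f x = 0"
  shows "l = 0"
  using tendsto_unique[OF assms(1,2) tendsto_eventually[OF assms(3)]] .

lemma second_order_tendsto:
  fixes f :: "real \<Rightarrow> real"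
  assumes "(\<lambda>M. f M - a - M\<^sup>2 * b) \<in> o[at_right 0](\<lambda>M. M\<^sup>2)"
  shows "((\<lambda>M. (f M - a) / M\<^sup>2) \<longlongrightarrow> b) (at_right 0)" and "(f \<longlongrightarrow> a) (at_right 0)"
proof -
  have pos: "\<forall>\<^sub>F M in at_right (0::real). M > 0" by (rule eventually_at_right_less)
  have "((\<lambda>M. (f M - a - M\<^sup>2 * b) / M\<^sup>2 + b) \<longlongrightarrow> 0 + b) (at_right 0)"
    by (intro tendsto_add tendsto_const smalloD_tendsto[OF assms])
  moreover have "\<forall>\<^sub>F M in at_right 0. (f M - a - M\<^sup>2 * b) / M\<^sup>2 + b = (f M - a) / M\<^sup>2"
    using pos by eventually_elim (simp add: field_simps)
  ultimately show *: "((\<lambda>M. (f M - a) / M\<^sup>2) \<longlongrightarrow> b) (at_right 0)"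
    by (simp add: Lim_transform_eventually)
  have "((\<lambda>M. a + M\<^sup>2 * ((f M - a) / M\<^sup>2)) \<longlongrightarrow> a + 0\<^sup>2 * b) (at_right 0)"
    by (intro tendsto_intros *)
  moreover have "\<forall>\<^sub>F M in at_right 0. a + M\<^sup>2 * ((f M - a) / M\<^sup>2) = f M"
    using pos by eventually_elim (simp add: field_simps)
  ultimately show "(f \<longlongrightarrow> a) (at_right 0)"
    by (simp add: Lim_transform_eventually)
qed

section \<open>The density is constant in time\<close>

lemma convex_deriv_monotone:
  fixes f :: "real \<Rightarrow> real"
  assumes f: "convex_on {0<..} f" and diff: "\<And>x. x > 0 \<Longrightarrow> f field_differentiable (at x)"
    and "x > 0" "y > 0"
  shows "0 \<le> (deriv f x - deriv f y) * (x - y)"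
proof -
  have tangent: "f b - f a \<ge> deriv f a * (b - a)" if "a > 0" "b > 0" for a b
    using that diff[OF \<open>a > 0\<close>]
    by (intro convex_on_imp_above_tangent[OF f])
      (auto simp: interior_open field_differentiable_derivI intro: has_field_derivative_at_within)
  from tangent[OF \<open>x > 0\<close> \<open>y > 0\<close>] tangent[OF \<open>y > 0\<close> \<open>x > 0\<close>] show ?thesis
    by (simp add: algebra_simps)
qed

lemma C2_on_deriv_continuous:
  assumes "C2_on {0<..} f"
  shows "continuous_on {0<..} (deriv f)"
  using assms by (auto simp: C2_on_def intro!: continuous_at_imp_continuous_on field_differentiable_imp_continuous_at)

text \<open>
  The functions \<open>r\<close> and \<open>r'\<close> approximate the old and the new density, \<open>L\<close> the new potential.
  Subtracting the equilibrium of \<open>\<rho>\<close> from the potential equation leaves \<open>p r' - p r\<close>. Testing with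
  \<open>r' - r\<close> uses the sign of this difference before the limit is taken. This matters because the limit
  \<open>\<rho>'\<close> is only known to be nonnegative, and \<open>p\<close> need not extend continuously to 0.
\<close>

lemma density_preserved:
  fixes r r' L :: "'a \<Rightarrow> real grid_fun" and \<rho> \<rho>' :: "real grid_fun" and p q :: "real \<Rightarrow> real"
  assumes "F \<noteq> bot" and h: "h > 0" and \<gamma>: "\<gamma> > 0"
    and mono: "\<And>x y. x > 0 \<Longrightarrow> y > 0 \<Longrightarrow> 0 \<le> (p x - p y) * (x - y)"
    and cont: "continuous_on {0<..} p" "continuous_on {0<..} q"
    and pos: "\<And>i j. (i, j) \<in> grid K \<Longrightarrow> \<forall>\<^sub>F M in F. r M i j > 0 \<and> r' M i j > 0"
    and eq: "\<And>i j. (i, j) \<in> grid K \<Longrightarrow>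
      \<forall>\<^sub>F M in F. L M i j - p (r' M i j) + q (r M i j) + \<gamma> * lap_h h (r' M) i j = 0"
    and r: "\<And>i j. (i, j) \<in> ghost_grid K \<Longrightarrow> ((\<lambda>M. r M i j) \<longlongrightarrow> \<rho> i j) F"
    and r': "\<And>i j. (i, j) \<in> ghost_grid K \<Longrightarrow> ((\<lambda>M. r' M i j) \<longlongrightarrow> \<rho>' i j) F"
    and L: "\<And>i j. (i, j) \<in> grid K \<Longrightarrow> ((\<lambda>M. L M i j) \<longlongrightarrow> b) F"
    and ghosts: "even_ghosts K \<rho>" "even_ghosts K \<rho>'"
    and \<rho>_pos: "\<And>i j. (i, j) \<in> grid K \<Longrightarrow> \<rho> i j > 0"
    and equil: "\<And>i j. (i, j) \<in> grid K \<Longrightarrow> p (\<rho> i j) - q (\<rho> i j) - \<gamma> * lap_h h \<rho> i j = c"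
    and mass: "(\<Sum>(i, j)\<in>grid K. \<rho>' i j) = (\<Sum>(i, j)\<in>grid K. \<rho> i j)"
    and ij: "(i, j) \<in> grid K"
  shows "\<rho>' i j = \<rho> i j"
proof -
  define e where "e M i j = p (r M i j) - q (r M i j) - \<gamma> * lap_h h (r M) i j" for M i j
  define \<delta> where "\<delta> i j = \<rho>' i j - \<rho> i j" for i j
  have grid_lim: "((\<lambda>M. r M i j) \<longlongrightarrow> \<rho> i j) F" "((\<lambda>M. r' M i j) \<longlongrightarrow> \<rho>' i j) F"
    if "(i, j) \<in> grid K" for i j
    by (rule r r', rule neighbours_in_ghost_grid(1)[OF that])+
  have e: "((\<lambda>M. e M i j) \<longlongrightarrow> c) F" if "(i, j) \<in> grid K" for i j
    unfolding e_def equil[OF that, symmetric]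
  proof (intro tendsto_intros tendsto_lap_h[OF r that])
    have "isCont p (\<rho> i j)" "isCont q (\<rho> i j)"
      using cont \<rho>_pos[OF that] by (auto simp: continuous_on_eq_continuous_at)
    then show "((\<lambda>M. p (r M i j)) \<longlongrightarrow> p (\<rho> i j)) F" "((\<lambda>M. q (r M i j)) \<longlongrightarrow> q (\<rho> i j)) F"
      using grid_lim(1)[OF that] by (auto intro: isCont_tendsto_compose)
  qed
  have lap_\<delta>: "lap_h h \<delta> i j = lap_h h \<rho>' i j - lap_h h \<rho> i j" for i j
    by (simp add: lap_h_def \<delta>_def diff_divide_distrib add_divide_distrib algebra_simps)
  have "0 \<le> (b - c + \<gamma> * lap_h h \<delta> i j) * \<delta> i j" if "(i, j) \<in> grid K" for i j
  proof (rule tendsto_lowerbound)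
    show "((\<lambda>M. (L M i j - e M i j + \<gamma> * (lap_h h (r' M) i j - lap_h h (r M) i j)) * (r' M i j - r M i j))
        \<longlongrightarrow> (b - c + \<gamma> * lap_h h \<delta> i j) * \<delta> i j) F"
      unfolding lap_\<delta> \<delta>_def
      by (intro tendsto_intros L e that grid_lim tendsto_lap_h[where K = K] r r')
    show "\<forall>\<^sub>F M in F. 0 \<le> (L M i j - e M i j + \<gamma> * (lap_h h (r' M) i j - lap_h h (r M) i j)) * (r' M i j - r M i j)"
      using pos[OF that] eq[OF that]
    proof eventually_elim
      case (elim M)
      then have "L M i j - e M i j + \<gamma> * (lap_h h (r' M) i j - lap_h h (r M) i j) = p (r' M i j) - p (r M i j)"
        by (simp add: e_def algebra_simps)
      with elim mono show ?case by simp
    qed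
  qed fact
  then have "0 \<le> (\<Sum>(i, j)\<in>grid K. (b - c + \<gamma> * lap_h h \<delta> i j) * \<delta> i j)"
    by (intro sum_nonneg) auto
  also have "\<dots> = (b - c) * (\<Sum>(i, j)\<in>grid K. \<delta> i j) + \<gamma> * (\<Sum>(i, j)\<in>grid K. \<delta> i j * lap_h h \<delta> i j)"
    by (simp add: case_prod_beta sum_distrib_left sum.distrib[symmetric] algebra_simps)
  also have sum0: "(\<Sum>(i, j)\<in>grid K. \<delta> i j) = 0"
    using mass by (simp add: \<delta>_def case_prod_beta sum_subtractf)
  finally have "0 \<le> (\<Sum>(i, j)\<in>grid K. \<delta> i j * lap_h h \<delta> i j)"
    using \<gamma> by (simp add: zero_le_mult_iff)
  moreover have "even_ghosts K \<delta>"
    using ghosts by (simp add: even_ghosts_def \<delta>_def)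
  ultimately have const: "\<delta> i j = \<delta> 0 0" if "(i, j) \<in> grid K" for i j
    using lap_nonneg_constant h that by blast
  have "(\<Sum>(i, j)\<in>grid K. \<delta> i j) = (\<Sum>(i, j)\<in>grid K. \<delta> 0 0)"
    by (intro sum.cong refl) (auto simp: const)
  with sum0 have "\<delta> 0 0 = 0" by (simp add: grid_def case_prod_beta)
  with const[OF ij] show ?thesis by (simp add: \<delta>_def)
qed

section \<open>The discrete energy inequality\<close>

lemma norm_le_maxnorm:
  assumes "(i, j) \<in> grid K"
  shows "norm (f i j) \<le> maxnorm K f"
  unfolding maxnorm_def using assms by (intro Max_ge) force+

lemma gridmin_le:
  assumes "(i, j) \<in> grid K"
  shows "gridmin K f \<le> f i j"
  unfolding gridmin_def using assms by (intro Min_le) force+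

theorem lemma4p7:
  fixes K N n :: nat
    and T \<gamma> :: real
    and t :: "nat \<Rightarrow> real"
    and W U V :: "real \<Rightarrow> real"
    and \<rho> \<Lambda> :: "real \<Rightarrow> nat \<Rightarrow> real grid_fun"
    and v :: "real \<Rightarrow> nat \<Rightarrow> (real ^ 2) grid_fun"
    and \<rho>0 \<rho>1 \<Lambda>0 \<Lambda>1 :: "nat \<Rightarrow> real grid_fun"
    and v0 :: "nat \<Rightarrow> (real ^ 2) grid_fun"
    and \<mu> :: "nat \<Rightarrow> real"
  assumes "K \<ge> 1" and "time_grid N T t" and "\<gamma> > 0"
    and "double_well W" and "convex_splitting W U V"
    and viscosity: "\<And>m. m < N \<Longrightarrow> \<mu> m = mesh K * maxnorm K (v0 m)"
    and solution: "\<forall>\<^sub>F M in at_right 0. scheme_solution K N t \<gamma> U V \<mu> M (\<rho> M) (v M) (\<Lambda> M)"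
    and coeff_ghosts: "\<And>m. m \<le> N \<Longrightarrow> even_ghosts K (\<rho>0 m) \<and> odd_ghosts K (v0 m)"
    and expansion_\<rho>: "\<And>m i j. m \<le> N \<Longrightarrow> (i, j) \<in> grid K \<Longrightarrow>
      (\<lambda>M. \<rho> M m i j - \<rho>0 m i j - M\<^sup>2 * \<rho>1 m i j) \<in> o[at_right 0](\<lambda>M. M\<^sup>2)"
    and expansion_v: "\<And>m i j. m \<le> N \<Longrightarrow> (i, j) \<in> grid K \<Longrightarrow>
      (\<lambda>M. norm (v M m i j - v0 m i j)) \<in> o[at_right 0](\<lambda>M. 1)"
    and expansion_\<Lambda>: "\<And>m i j. m \<in> {1..N} \<Longrightarrow> (i, j) \<in> grid K \<Longrightarrow>
      (\<lambda>M. \<Lambda> M m i j - \<Lambda>0 m i j - M\<^sup>2 * \<Lambda>1 m i j) \<in> o[at_right 0](\<lambda>M. M\<^sup>2)"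
    and initial_potential: "\<exists>c. \<forall>(i, j)\<in>grid K.
      deriv W (\<rho>0 0 i j) - \<gamma> * lap_h (mesh K) (\<rho>0 0) i j = c"
    and initial_div: "\<forall>(i, j)\<in>grid K. div_h (mesh K) (\<lambda>k l. \<rho>0 0 k l *\<^sub>R v0 0 k l) i j = 0"
    and initial_pos: "\<forall>(i, j)\<in>grid K. \<rho>0 0 i j > 0"
    and "n < N"
    and cfl: "maxnorm K (v0 n) \<noteq> 0 \<Longrightarrow>
      time_step t n < mesh K / maxnorm K (v0 n)
        * (gridmin K (\<rho>0 0) / (9 * (maxnorm K (\<rho>0 0))\<^sup>2 + 8))"
  shows "(\<Sum>(i, j)\<in>grid K. \<rho>0 0 i j * (norm (v0 (Suc n) i j))\<^sup>2)
    \<le> (\<Sum>(i, j)\<in>grid K. \<rho>0 0 i j * (norm (v0 n i j))\<^sup>2)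
      + \<mu> n * time_step t n / (mesh K)\<^sup>2
          * (\<Sum>(i, j)\<in>bdry K. (norm (v0 (Suc n) i j - v0 n i j))\<^sup>2)
      + 4 * (\<mu> n * time_step t n / (mesh K)\<^sup>2)
          * (\<Sum>(i, j)\<in>bdry K. v0 n i j \<bullet> (v0 n i j - v0 (Suc n) i j))"
proof -
  let ?F = "at_right (0 :: real)"
  let ?h = "mesh K"
  have h: "?h > 0" using \<open>K \<ge> 1\<close> by (simp add: mesh_def)
  have \<tau>: "time_step t m > 0" if "m < N" for m
    using that \<open>time_grid N T t\<close> by (simp add: time_grid_def time_step_def)

  have \<rho>_even: "\<forall>\<^sub>F M in ?F. even_ghosts K (\<rho> M m)" if "m \<le> N" for m
    using solution by eventually_elim (simp add: scheme_solution_def that)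
  have v_odd: "\<forall>\<^sub>F M in ?F. odd_ghosts K (v M m)" if "m \<le> N" for m
    using solution by eventually_elim (simp add: scheme_solution_def that)
  have \<Lambda>_even: "\<forall>\<^sub>F M in ?F. even_ghosts K (\<Lambda> M m)" if "m \<in> {1..N}" for m
    using solution by eventually_elim (use that in \<open>simp add: scheme_solution_def\<close>)
  have \<rho>_pos: "\<forall>\<^sub>F M in ?F. \<rho> M m i j > 0" if "m \<le> N" "(i, j) \<in> grid K" for m i j
    using solution by eventually_elim (use that in \<open>auto simp: scheme_solution_def\<close>)
  have mass_eq: "\<forall>\<^sub>F M in ?F. \<rho> M (Suc m) i j - \<rho> M m i j
      + time_step t m * div_h ?h (\<lambda>k l. \<rho> M (Suc m) k l *\<^sub>R v M (Suc m) k l) i j = 0"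
    if "m < N" "(i, j) \<in> grid K" for m i j
    using solution by eventually_elim (use that in \<open>auto simp: scheme_solution_def\<close>)
  have momentum_eq: "\<forall>\<^sub>F M in ?F. \<rho> M (Suc m) i j *\<^sub>R v M (Suc m) i j - \<rho> M m i j *\<^sub>R v M m i j
      + time_step t m *\<^sub>R conv_h ?h (\<rho> M m) (v M m) i j
      + (\<rho> M m i j * (time_step t m / M\<^sup>2)) *\<^sub>R grad_h ?h (\<Lambda> M (Suc m)) i j
      - (\<mu> m * time_step t m) *\<^sub>R lap_h ?h (v M m) i j = 0"
    if "m < N" "(i, j) \<in> grid K" for m i j
    using solution by eventually_elim (use that in \<open>auto simp: scheme_solution_def\<close>)
  have potential_eq: "\<forall>\<^sub>F M in ?F. \<Lambda> M (Suc m) i j - deriv U (\<rho> M (Suc m) i j) + deriv V (\<rho> M m i j)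
      + \<gamma> * lap_h ?h (\<rho> M (Suc m)) i j = 0"
    if "m < N" "(i, j) \<in> grid K" for m i j
    using solution by eventually_elim (use that in \<open>auto simp: scheme_solution_def\<close>)

  have \<rho>_lim: "((\<lambda>M. \<rho> M m i j) \<longlongrightarrow> \<rho>0 m i j) ?F" if "m \<le> N" "(i, j) \<in> ghost_grid K" for m i j
    using that coeff_ghosts[of m]
    by (auto intro: even_ghosts_tendsto[OF \<rho>_even _ second_order_tendsto(2)[OF expansion_\<rho>]])
  have v_lim: "((\<lambda>M. v M m i j) \<longlongrightarrow> v0 m i j) ?F" if "m \<le> N" "(i, j) \<in> ghost_grid K" for m i j
  proof (rule odd_ghosts_tendsto[OF v_odd _ _ that(2)])
    fix i j assume "(i, j) \<in> grid K"
    from smalloD_tendsto[OF expansion_v[OF \<open>m \<le> N\<close> this]]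
    have "((\<lambda>M. v M m i j - v0 m i j) \<longlongrightarrow> 0) ?F" by (simp add: tendsto_norm_zero_iff)
    then show "((\<lambda>M. v M m i j) \<longlongrightarrow> v0 m i j) ?F" by (rule LIM_zero_cancel)
  qed (use that coeff_ghosts[of m] in auto)

  have inertia_lim: "((\<lambda>M. \<rho> M (Suc m) i j *\<^sub>R v M (Suc m) i j - \<rho> M m i j *\<^sub>R v M m i j
      + time_step t m *\<^sub>R conv_h ?h (\<rho> M m) (v M m) i j
      - (\<mu> m * time_step t m) *\<^sub>R lap_h ?h (v M m) i j)
    \<longlongrightarrow> \<rho>0 (Suc m) i j *\<^sub>R v0 (Suc m) i j - \<rho>0 m i j *\<^sub>R v0 m i j
      + time_step t m *\<^sub>R conv_h ?h (\<rho>0 m) (v0 m) i j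
      - (\<mu> m * time_step t m) *\<^sub>R lap_h ?h (v0 m) i j) ?F"
    if "m < N" "(i, j) \<in> grid K" for m i j
    using that
    by (intro tendsto_intros tendsto_conv_h[where K = K] tendsto_lap_h[where K = K] \<rho>_lim v_lim
        neighbours_in_ghost_grid(1)[OF that(2)]) auto

  have mass_lim: "\<rho>0 (Suc m) i j - \<rho>0 m i j
      + time_step t m * div_h ?h (\<lambda>k l. \<rho>0 (Suc m) k l *\<^sub>R v0 (Suc m) k l) i j = 0"
    if "m < N" "(i, j) \<in> grid K" for m i j
  proof (rule tendsto_eventually_zero[OF _ _ mass_eq[OF that]])
    show "((\<lambda>M. \<rho> M (Suc m) i j - \<rho> M m i j
        + time_step t m * div_h ?h (\<lambda>k l. \<rho> M (Suc m) k l *\<^sub>R v M (Suc m) k l) i j)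
      \<longlongrightarrow> \<rho>0 (Suc m) i j - \<rho>0 m i j
        + time_step t m * div_h ?h (\<lambda>k l. \<rho>0 (Suc m) k l *\<^sub>R v0 (Suc m) k l) i j) ?F"
      using that(1)
      by (intro tendsto_intros tendsto_div_h[where K = K] \<rho>_lim v_lim that(2)
          neighbours_in_ghost_grid(1)[OF that(2)]) auto
  qed simp

  \<comment> \<open>After multiplication by \<open>M\<^sup>2\<close> only the pressure gradient survives in the limit.\<close>
  have \<Lambda>0_const: "\<Lambda>0 (Suc m) i j = \<Lambda>0 (Suc m) 0 0"
    if m: "m < N" and pos: "\<And>i j. (i, j) \<in> grid K \<Longrightarrow> \<rho>0 m i j > 0" and ij: "(i, j) \<in> grid K" for m i j
  proof -
    let ?L = "\<lambda>i j. \<Lambda>0 (Suc m) (clamp_index K i) (clamp_index K j)"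
    have "grad_h ?h ?L k l = 0" if kl: "(k, l) \<in> grid K" for k l
    proof -
      let ?X = "\<lambda>M. \<rho> M (Suc m) k l *\<^sub>R v M (Suc m) k l - \<rho> M m k l *\<^sub>R v M m k l
        + time_step t m *\<^sub>R conv_h ?h (\<rho> M m) (v M m) k l
        - (\<mu> m * time_step t m) *\<^sub>R lap_h ?h (v M m) k l"
      let ?f = "\<lambda>M. M\<^sup>2 *\<^sub>R ?X M + (\<rho> M m k l * time_step t m) *\<^sub>R grad_h ?h (\<Lambda> M (Suc m)) k l"
      have "\<forall>\<^sub>F M in ?F. ?f M = 0"
        using momentum_eq[OF m kl] eventually_at_right_less[of 0]
      proof eventually_elim
        case (elim M)
        have "?f M = M\<^sup>2 *\<^sub>R (?X M + (\<rho> M m k l * (time_step t m / M\<^sup>2)) *\<^sub>R grad_h ?h (\<Lambda> M (Suc m)) k l)"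
          using elim(2) by (simp add: scaleR_add_right)
        also have "?X M + (\<rho> M m k l * (time_step t m / M\<^sup>2)) *\<^sub>R grad_h ?h (\<Lambda> M (Suc m)) k l = 0"
          using elim(1) by (simp add: algebra_simps)
        finally show ?case by simp
      qed
      moreover have "(?f \<longlongrightarrow> 0\<^sup>2 *\<^sub>R (\<rho>0 (Suc m) k l *\<^sub>R v0 (Suc m) k l - \<rho>0 m k l *\<^sub>R v0 m k l
          + time_step t m *\<^sub>R conv_h ?h (\<rho>0 m) (v0 m) k l
          - (\<mu> m * time_step t m) *\<^sub>R lap_h ?h (v0 m) k l)
        + (\<rho>0 m k l * time_step t m) *\<^sub>R grad_h ?h ?L k l) ?F"
      proof (rule tendsto_add[OF tendsto_scaleR[OF _ inertia_lim[OF m kl]] tendsto_scaleR])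
        show "((\<lambda>M. grad_h ?h (\<Lambda> M (Suc m)) k l) \<longlongrightarrow> grad_h ?h ?L k l) ?F"
        proof (rule tendsto_grad_h[OF even_ghosts_tendsto[OF \<Lambda>_even even_ghosts_clamp_index] kl])
          fix i j assume ij: "(i, j) \<in> grid K"
          show "((\<lambda>M. \<Lambda> M (Suc m) i j) \<longlongrightarrow> ?L i j) ?F"
            using second_order_tendsto(2)[OF expansion_\<Lambda>[OF _ ij, of "Suc m"]] m gridD[OF ij] by simp
        qed (use m in auto)
        show "((\<lambda>M. \<rho> M m k l * time_step t m) \<longlongrightarrow> \<rho>0 m k l * time_step t m) ?F"
          using m by (intro tendsto_intros \<rho>_lim neighbours_in_ghost_grid(1)[OF kl]) simp
        show "((\<lambda>M. M\<^sup>2) \<longlongrightarrow> 0\<^sup>2) ?F" by (intro tendsto_intros)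
      qed
      ultimately have "(\<rho>0 m k l * time_step t m) *\<^sub>R grad_h ?h ?L k l = 0"
        using tendsto_eventually_zero[of ?F] by fastforce
      then show ?thesis using pos[OF kl] \<tau>[OF m] by simp
    qed
    from grad_zero_constant[OF even_ghosts_clamp_index h this ij] gridD[OF ij] show ?thesis
      by simp
  qed

  obtain c where c: "\<And>i j. (i, j) \<in> grid K \<Longrightarrow>
      deriv W (\<rho>0 0 i j) - \<gamma> * lap_h ?h (\<rho>0 0) i j = c"
    using initial_potential by auto
  have UV: "C2_on {0<..} U" "C2_on {0<..} V" "convex_on {0<..} U" "\<And>x. x > 0 \<Longrightarrow> W x = U x - V x"
    using \<open>convex_splitting W U V\<close> by (auto simp: convex_splitting_def)
  have deriv_W: "deriv W x = deriv U x - deriv V x" if "x > 0" for x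
  proof -
    have "(U has_field_derivative deriv U x) (at x)" "(V has_field_derivative deriv V x) (at x)"
      using UV(1,2) that by (auto simp: C2_on_def intro: field_differentiable_derivI)
    then have "((\<lambda>x. U x - V x) has_field_derivative deriv U x - deriv V x) (at x)"
      by (rule DERIV_diff)
    then have "(W has_field_derivative deriv U x - deriv V x) (at x)"
      by (rule has_field_derivative_transform_within_open[where S = "{0<..}"]) (use UV(4) that in auto)
    then show ?thesis by (rule DERIV_imp_deriv)
  qed
  have \<rho>0_0_pos: "\<rho>0 0 i j > 0" if "(i, j) \<in> grid K" for i j
    using initial_pos that by auto
  \<comment> \<open>The equilibrium condition is known for the initial density, so the step is taken from a level
    at which the density still has its initial values.\<close>
  have \<rho>0_step: "\<rho>0 (Suc m) i j = \<rho>0 m i j"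
    if m: "m < N" and const: "\<And>i j. (i, j) \<in> ghost_grid K \<Longrightarrow> \<rho>0 m i j = \<rho>0 0 i j"
      and ij: "(i, j) \<in> grid K" for m i j
  proof (rule density_preserved[OF _ h \<open>\<gamma> > 0\<close>, where K = K and F = ?F and p = "deriv U" and q = "deriv V"
        and r = "\<lambda>M. \<rho> M m" and r' = "\<lambda>M. \<rho> M (Suc m)" and L = "\<lambda>M. \<Lambda> M (Suc m)"
        and b = "\<Lambda>0 (Suc m) 0 0" and c = c])
    show "0 \<le> (deriv U x - deriv U y) * (x - y)" if "x > 0" "y > 0" for x y
      using that UV(1,3) by (intro convex_deriv_monotone) (auto simp: C2_on_def)
    have pos: "\<rho>0 m i j > 0" if "(i, j) \<in> grid K" for i j
      using const \<rho>0_0_pos neighbours_in_ghost_grid(1) that by metis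
    then show "\<rho>0 m i j > 0" if "(i, j) \<in> grid K" for i j using that .
    show "\<forall>\<^sub>F M in ?F. \<rho> M m i j > 0 \<and> \<rho> M (Suc m) i j > 0" if "(i, j) \<in> grid K" for i j
      using m that by (intro eventually_conj \<rho>_pos) auto
    show "((\<lambda>M. \<Lambda> M (Suc m) i j) \<longlongrightarrow> \<Lambda>0 (Suc m) 0 0) ?F" if "(i, j) \<in> grid K" for i j
      using second_order_tendsto(2)[OF expansion_\<Lambda>[OF _ that, of "Suc m"]] m \<Lambda>0_const[OF m pos that]
      by simp
    show "deriv U (\<rho>0 m i j) - deriv V (\<rho>0 m i j) - \<gamma> * lap_h ?h (\<rho>0 m) i j = c"
      if ij: "(i, j) \<in> grid K" for i j
    proof -
      have "lap_h ?h (\<rho>0 m) i j = lap_h ?h (\<rho>0 0) i j"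
        by (simp add: lap_h_def const neighbours_in_ghost_grid[OF ij])
      then show ?thesis
        using c[OF ij] deriv_W[OF \<rho>0_0_pos[OF ij]] const[OF neighbours_in_ghost_grid(1)[OF ij]] by simp
    qed
    have "(\<Sum>(i, j)\<in>grid K. \<rho>0 (Suc m) i j - \<rho>0 m i j)
        = (\<Sum>(i, j)\<in>grid K. - time_step t m * div_h ?h (\<lambda>k l. \<rho>0 (Suc m) k l *\<^sub>R v0 (Suc m) k l) i j)"
      using mass_lim[OF m] by (intro sum.cong refl) (auto simp: algebra_simps add_eq_0_iff)
    also have "\<dots> = 0"
      using sum_div_h_zero[OF odd_ghosts_scaleR, of K "\<rho>0 (Suc m)" "v0 (Suc m)" ?h] coeff_ghosts[of "Suc m"] m
      by (simp add: sum_distrib_left[symmetric] case_prod_beta sum_negf)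
    finally show "(\<Sum>(i, j)\<in>grid K. \<rho>0 (Suc m) i j) = (\<Sum>(i, j)\<in>grid K. \<rho>0 m i j)"
      by (simp add: case_prod_beta sum_subtractf)
  qed (use m ij coeff_ghosts potential_eq in \<open>auto intro: C2_on_deriv_continuous UV(1,2) \<rho>_lim\<close>)
  have \<rho>0_const: "\<forall>(i, j)\<in>ghost_grid K. \<rho>0 m i j = \<rho>0 0 i j" if "m \<le> N" for m
    using that
  proof (induction m)
    case (Suc m)
    then have const: "\<rho>0 m i j = \<rho>0 0 i j" if "(i, j) \<in> ghost_grid K" for i j
      using that by auto
    have "\<rho>0 (Suc m) i j = \<rho>0 0 i j" if "(i, j) \<in> ghost_grid K" for i j
    proof -
      have "\<rho>0 (Suc m) i j = \<rho>0 (Suc m) (clamp_index K i) (clamp_index K j)"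
        using coeff_ghosts Suc.prems that by (blast intro: even_ghosts_value)
      also have "\<dots> = \<rho>0 m (clamp_index K i) (clamp_index K j)"
        using Suc.prems by (intro \<rho>0_step const clamp_index_grid) auto
      also have "\<dots> = \<rho>0 m i j"
        using coeff_ghosts Suc.prems that by (metis even_ghosts_value Suc_leD)
      finally show ?thesis using const[OF that] by simp
    qed
    then show ?case by auto
  qed auto
  have const: "\<rho>0 m i j = \<rho>0 0 i j" if "m \<le> N" "(i, j) \<in> ghost_grid K" for m i j
    using \<rho>0_const that by auto
  have div_zero: "div_h ?h (\<lambda>k l. \<rho>0 0 k l *\<^sub>R v0 m k l) i j = 0"
    if m: "m \<le> N" and ij: "(i, j) \<in> grid K" for m i j
  proof (cases m)
    case 0
    then show ?thesis using initial_div ij by auto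
  next
    case (Suc k)
    have "div_h ?h (\<lambda>k l. \<rho>0 0 k l *\<^sub>R v0 m k l) i j = div_h ?h (\<lambda>k l. \<rho>0 m k l *\<^sub>R v0 m k l) i j"
      by (simp add: div_h_def const[OF m] neighbours_in_ghost_grid[OF ij])
    also have "\<dots> = 0"
      using mass_lim[of k i j] \<tau>[of k] Suc m ij const[of m i j] const[of k i j] neighbours_in_ghost_grid(1)[OF ij]
      by simp
    finally show ?thesis .
  qed

  let ?L = "\<lambda>i j. \<Lambda>1 (Suc n) (clamp_index K i) (clamp_index K j)"
  \<comment> \<open>As \<open>\<Lambda>\<^sub>0\<close> is constant, it may be subtracted under the gradient before dividing by \<open>M\<^sup>2\<close>; the
    quotient tends to \<open>\<Lambda>\<^sub>1\<close>.\<close>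
  have momentum_lim: "\<rho>0 0 i j *\<^sub>R v0 (Suc n) i j - \<rho>0 0 i j *\<^sub>R v0 n i j
      + time_step t n *\<^sub>R conv_h ?h (\<rho>0 0) (v0 n) i j
      + (\<rho>0 0 i j * time_step t n) *\<^sub>R grad_h ?h ?L i j
      - (\<mu> n * time_step t n) *\<^sub>R lap_h ?h (v0 n) i j = 0" if ij: "(i, j) \<in> grid K" for i j
  proof -
    let ?X = "\<lambda>M. \<rho> M (Suc n) i j *\<^sub>R v M (Suc n) i j - \<rho> M n i j *\<^sub>R v M n i j
      + time_step t n *\<^sub>R conv_h ?h (\<rho> M n) (v M n) i j
      - (\<mu> n * time_step t n) *\<^sub>R lap_h ?h (v M n) i j"
    let ?G = "\<lambda>M k l. (\<Lambda> M (Suc n) k l - \<Lambda>0 (Suc n) 0 0) / M\<^sup>2"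
    let ?f = "\<lambda>M. ?X M + (\<rho> M n i j * time_step t n) *\<^sub>R grad_h ?h (?G M) i j"
    have pos: "\<rho>0 n i j > 0" if "(i, j) \<in> grid K" for i j
      using const[of n i j] \<rho>0_0_pos neighbours_in_ghost_grid(1) that \<open>n < N\<close> by simp
    have "\<forall>\<^sub>F M in ?F. ?f M = 0"
      using momentum_eq[OF \<open>n < N\<close> ij]
    proof eventually_elim
      case (elim M)
      have "grad_h ?h (?G M) i j = (1 / M\<^sup>2) *\<^sub>R grad_h ?h (\<Lambda> M (Suc n)) i j"
        by (simp add: grad_h_def vec_eq_iff forall_2 diff_divide_distrib[symmetric])
      with elim show ?case by (simp add: algebra_simps)
    qed
    moreover have "(?f \<longlongrightarrow> (\<rho>0 (Suc n) i j *\<^sub>R v0 (Suc n) i j - \<rho>0 n i j *\<^sub>R v0 n i j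
        + time_step t n *\<^sub>R conv_h ?h (\<rho>0 n) (v0 n) i j
        - (\<mu> n * time_step t n) *\<^sub>R lap_h ?h (v0 n) i j)
      + (\<rho>0 n i j * time_step t n) *\<^sub>R grad_h ?h ?L i j) ?F"
    proof (rule tendsto_add[OF inertia_lim[OF \<open>n < N\<close> ij] tendsto_scaleR])
      show "((\<lambda>M. grad_h ?h (?G M) i j) \<longlongrightarrow> grad_h ?h ?L i j) ?F"
      proof (rule tendsto_grad_h[OF even_ghosts_tendsto[OF _ even_ghosts_clamp_index] ij])
        show "\<forall>\<^sub>F M in ?F. even_ghosts K (?G M)"
          using \<Lambda>_even[of "Suc n"] \<open>n < N\<close> by (auto simp: even_ghosts_def elim: eventually_mono)
        fix k l assume kl: "(k, l) \<in> grid K"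
        show "((\<lambda>M. ?G M k l) \<longlongrightarrow> ?L k l) ?F"
          using second_order_tendsto(1)[OF expansion_\<Lambda>[OF _ kl, of "Suc n"]] \<open>n < N\<close>
            \<Lambda>0_const[OF \<open>n < N\<close> pos kl] gridD[OF kl] by simp
      qed
      show "((\<lambda>M. \<rho> M n i j * time_step t n) \<longlongrightarrow> \<rho>0 n i j * time_step t n) ?F"
        using \<open>n < N\<close> by (intro tendsto_intros \<rho>_lim neighbours_in_ghost_grid(1)[OF ij]) simp
    qed
    ultimately have "(\<rho>0 (Suc n) i j *\<^sub>R v0 (Suc n) i j - \<rho>0 n i j *\<^sub>R v0 n i j
        + time_step t n *\<^sub>R conv_h ?h (\<rho>0 n) (v0 n) i j
        - (\<mu> n * time_step t n) *\<^sub>R lap_h ?h (v0 n) i j)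
      + (\<rho>0 n i j * time_step t n) *\<^sub>R grad_h ?h ?L i j = 0"
      using tendsto_eventually_zero[of ?F] by fastforce
    moreover have "conv_h ?h (\<rho>0 n) (v0 n) i j = conv_h ?h (\<rho>0 0) (v0 n) i j"
      using \<open>n < N\<close> by (simp add: conv_h_def const[of n] neighbours_in_ghost_grid[OF ij])
    ultimately show ?thesis
      using \<open>n < N\<close> by (simp add: const[of n] const[of "Suc n"] neighbours_in_ghost_grid[OF ij] algebra_simps)
  qed

  have origin: "(0, 0) \<in> grid K" by (simp add: grid_def)
  have v_nonneg: "maxnorm K (v0 n) \<ge> 0"
    using norm_le_maxnorm[OF origin, of "v0 n"] norm_ge_zero order_trans by blast
  have \<rho>_nonneg: "maxnorm K (\<rho>0 0) \<ge> 0"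
    using norm_le_maxnorm[OF origin, of "\<rho>0 0"] norm_ge_zero order_trans by blast
  have \<mu>: "\<mu> n = ?h * maxnorm K (v0 n)" by (rule viscosity) fact
  \<comment> \<open>Where the velocity vanishes everywhere so does the viscosity, and the left-hand side is 0.\<close>
  have cfl': "\<mu> n * time_step t n / ?h\<^sup>2 * (2 * (maxnorm K (\<rho>0 0))\<^sup>2 + 8) \<le> \<rho>0 0 i j"
    if ij: "(i, j) \<in> grid K" for i j
  proof (cases "maxnorm K (v0 n) = 0")
    case True
    then show ?thesis using \<rho>0_0_pos[OF ij] by (simp add: \<mu>)
  next
    case False
    let ?l = "\<mu> n * time_step t n / ?h\<^sup>2" and ?R = "maxnorm K (\<rho>0 0)"
    have l: "?l = maxnorm K (v0 n) / ?h * time_step t n"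
      using h by (simp add: \<mu> power2_eq_square)
    have "?l \<ge> 0" using v_nonneg h \<tau>[OF \<open>n < N\<close>] by (simp add: l)
    then have "?l * (2 * ?R\<^sup>2 + 8) \<le> ?l * (9 * ?R\<^sup>2 + 8)"
      by (intro mult_left_mono) auto
    also have "\<dots> \<le> gridmin K (\<rho>0 0)"
    proof -
      have pos: "9 * ?R\<^sup>2 + 8 > 0" by (simp add: add_nonneg_pos)
      have "?l < gridmin K (\<rho>0 0) / (9 * ?R\<^sup>2 + 8)"
        using mult_strict_left_mono[OF cfl[OF False], of "maxnorm K (v0 n) / ?h"] h v_nonneg False
        by (simp add: l)
      then show ?thesis using pos by (simp add: pos_less_divide_eq)
    qed
    also have "\<dots> \<le> \<rho>0 0 i j" by (rule gridmin_le[OF ij])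
    finally show ?thesis .
  qed
  show ?thesis
  proof (rule energy_step[OF \<open>K \<ge> 1\<close> h _ v_nonneg \<rho>_nonneg \<mu> _ even_ghosts_clamp_index _ _ _ _
        momentum_lim _ norm_le_maxnorm cfl'])
    show "time_step t n \<ge> 0" using \<tau>[OF \<open>n < N\<close>] by simp
    show "even_ghosts K (\<rho>0 0)" "odd_ghosts K (v0 n)" "odd_ghosts K (v0 (Suc n))"
      using coeff_ghosts[of 0] coeff_ghosts[of n] coeff_ghosts[of "Suc n"] \<open>n < N\<close> by simp_all
    show "div_h ?h (\<lambda>k l. \<rho>0 0 k l *\<^sub>R v0 n k l) i j = 0"
      "div_h ?h (\<lambda>k l. \<rho>0 0 k l *\<^sub>R v0 (Suc n) k l) i j = 0" if "(i, j) \<in> grid K" for i j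
      using that \<open>n < N\<close> by (intro div_zero; simp)+
    show "\<bar>\<rho>0 0 i j\<bar> \<le> maxnorm K (\<rho>0 0)" if "(i, j) \<in> grid K" for i j
      using norm_le_maxnorm[OF that, of "\<rho>0 0"] by simp
  qed
qed

end
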